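(* The variance of $X_n$ satisfies, as $n\to\infty$, $$\mathrm{Var}(X_n)=\frac{n^3}{3(\log n)^2}\left(1+2\,\frac{\log\log n}{\log n}\,(1+o(1))\right).$$
   Context: $\Pi_n$ is the set of all partitions of $[n]=\{1,\dots,n\}$. For $\pi\in\Pi_n$, the arcs of its linear representation are the pairs $(i,j)$, $i<j$, where $i,j$ are consecutive elements (in increasing order) of the same block; $\mathrm{cr}^{(\ell)}(\pi)$ is the number of (unordered) pairs of crossing arcs, i.e. pairs of arcs $(i,j),(i',j')$ with $i<i'<j<j'$. $X_n$ is the random variable equal to $\mathrm{cr}^{(\ell)}(\pi)$ for $\pi$ uniformly distributed on $\Pi_n$. *)

theory Defs
  imports "HOL-Library.Disjoint_Sets" "HOL-Probability.Probability"
begin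

definition set_partitions :: "nat \<Rightarrow> nat set set set" where
  "set_partitions n = {P. partition_on {1..n} P}"

definition arcs :: "nat set set \<Rightarrow> (nat \<times> nat) set" where
  "arcs P = {(i, j). i < j \<and> (\<exists>B\<in>P. i \<in> B \<and> j \<in> B \<and> (\<forall>k\<in>B. \<not> (i < k \<and> k < j)))}"

(* The condition i < i' orders the two arcs, so every unordered crossing pair is counted once. *)
definition linear_crossings :: "nat set set \<Rightarrow> nat" where
  "linear_crossings P =
     card {((i, j), (i', j')). (i, j) \<in> arcs P \<and> (i', j') \<in> arcs P \<and> i < i' \<and> i' < j \<and> j < j'}"

definition random_partition :: "nat \<Rightarrow> nat set set pmf" where
  "random_partition n = pmf_of_set (set_partitions n)"

(* pmf_of_set is only meaningful on finite nonempty sets. *)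
lemma finite_set_partitions: "finite (set_partitions n)"
  unfolding set_partitions_def by (rule finitely_many_partition_on) simp

lemma set_partitions_nonempty: "set_partitions n \<noteq> {}"
proof -
  have "partition_on {1..n} ((\<lambda>x. {x}) ` {1..n})"
    by (auto simp: partition_on_def disjoint_def)
  then show ?thesis
    unfolding set_partitions_def by blast
qed

end

theory Submission
  imports Defs "HOL-Computational_Algebra.Polynomial" "HOL-Real_Asymp.Real_Asymp"
begin

text \<open>
  Let $X$ be the number of crossings of a uniform partition of $\{1, \dots, n\}$. The proof has an exact
  part and an asymptotic one.

  Build the partition by adding the elements one by one, with some blocks marked as open, that is,
  destined to grow. If an element joins one of $h$ open blocks, the arc that it closes is
  crossed by the pending arcs that start later (\<open>marked_crossings_extend\<close>), and the number of these takes each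
  of the values $0, \dots, h - 1$ exactly once. The generating polynomials of the binomial moments of the
  crossings, with a variable for the open blocks, therefore satisfy differential recurrences
  (\<open>crossing_poly_Suc\<close>). The first two moments can be solved for in terms of Touchard polynomials
  (\<open>crossing_poly_1_closed\<close>, \<open>crossing_poly_2_closed\<close>), so the moments of $X$ are combinations of Bell
  numbers. By the Dobinski formula $B_{n+j} / B_n$ is the $j$-th moment of a random number $M$ with
  probabilities proportional to $m^n / m!$, and the result takes the form
  \[ 144\,\mathrm{Var}(X) = 9\,\mathrm{Var}(2 n M + 9 M - 5 M^2) + 12 n\,\mathrm{E}(M^2) + \dots \]
  (\<open>variance_eq_exact_variance\<close>). The point of this arrangement is that all cancellation between
  $\mathrm{E}(X^2)$ and $\mathrm{E}(X)^2$ is hidden in a variance, so that crude estimates are enough from here on.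

  The law of $M$ is the stationary law of a birth-death chain with birth rate $\lambda(m) = (1 + 1/m)^n$ and death
  rate $m$, and thus satisfies a Stein identity (\<open>mean_stein\<close>). Let $c$ be the fixed point of $\lambda$ and $r = \ln c$, so that
  $n$ lies between $c r$ and $(c + 1) r$. The identity shows that $M$ is concentrated at $c$ on the scale $\sqrt c$
  (\<open>mean_dev2\<close>, \<open>mean_dev4\<close>), and since $m - \lambda(m)$ has slope close to $1 + r$ near $c$, it yields
  $\mathrm{Var}(M) = c / r$ up to a relative error of order $1 / r$ (\<open>mean_dev2_upper\<close>, \<open>variance_lower\<close>).
  Hence $\mathrm{Var}(X) = \frac14 n^2 \cdot c / r + \frac1{12} n c^2 + O(c^3) = \frac13 c^3 r + O(c^3)$
  (\<open>exact_variance_bounds\<close>).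

  Finally $n = c r (1 + O(1 / c))$ and $c = e^r$ give $\ln n = r + \ln r + o(1)$, so the variance is
  $n^3 / (3 r^2)$ up to a factor $1 + O(1 / r)$, and replacing $r$ by $\ln n$ produces the factor
  $1 + 2 \ln \ln n / \ln n$; the error $O(1 / r)$ is negligible compared with $\ln \ln n / \ln n$.
\<close>

section \<open>Marked partitions\<close>

definition marked_partitions :: "nat \<Rightarrow> (nat set set \<times> nat set set) set" where
  "marked_partitions n = {(P, Q). partition_on {1..n} P \<and> Q \<subseteq> P}"

definition open_crossings :: "nat set set \<Rightarrow> nat set set \<Rightarrow> nat" where
  "open_crossings P Q = card {(a, B). a \<in> arcs P \<and> B \<in> Q \<and> fst a < Max B \<and> Max B < snd a}"

text \<open>
  An open block will grow, so a pending arc leaves its largest element and ends beyond all present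
  elements. An arc of $P$ that covers this element therefore crosses the pending arc, whatever
  happens later, and the crossing is counted already now.
\<close>

definition marked_crossings :: "nat set set \<Rightarrow> nat set set \<Rightarrow> nat" where
  "marked_crossings P Q = linear_crossings P + open_crossings P Q"

text \<open>
  Appending \<open>m\<close> to the block \<open>B\<close>. The value \<open>B = {}\<close> stands for opening a new block, which treats both
  ways to place \<open>m\<close> at once; the flag of \<open>extend_marks\<close> tells whether the block of \<open>m\<close> remains open.
\<close>

definition extend :: "nat \<Rightarrow> nat set \<Rightarrow> nat set set \<Rightarrow> nat set set" where
  "extend m B P = insert (insert m B) (P - {B})"

definition extend_marks :: "nat \<Rightarrow> nat set \<Rightarrow> bool \<Rightarrow> nat set set \<Rightarrow> nat set set" where
  "extend_marks m B b Q = (if b then insert (insert m B) (Q - {B}) else Q - {B})"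

definition later_open :: "nat set set \<Rightarrow> nat set \<Rightarrow> nat" where
  "later_open Q B = (if B = {} then 0 else card {C \<in> Q. Max B < Max C})"

lemma finite_marked_partitions: "finite (marked_partitions n)"
proof (rule finite_subset)
  show "marked_partitions n \<subseteq> Pow (Pow {1..n}) \<times> Pow (Pow {1..n})"
    unfolding marked_partitions_def partition_on_def by blast
qed simp

lemma marked_partitionsD:
  assumes "(P, Q) \<in> marked_partitions n"
  shows "partition_on {1..n} P" "Q \<subseteq> P" "finite P" "finite Q" "{} \<notin> P" "{} \<notin> Q"
    "B \<in> P \<Longrightarrow> B \<subseteq> {1..n}" "B \<in> P \<Longrightarrow> finite B"
    "B \<in> P \<Longrightarrow> Suc n \<notin> B" "B \<in> P \<Longrightarrow> B \<noteq> {}"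
    "B \<in> P \<Longrightarrow> C \<in> P \<Longrightarrow> x \<in> B \<Longrightarrow> x \<in> C \<Longrightarrow> B = C"
proof -
  show *: "partition_on {1..n} P" "Q \<subseteq> P"
    using assms by (auto simp: marked_partitions_def)
  show **: "finite P" using *(1) by (meson finite_atLeastAtMost finite_elements)
  show "finite Q" using * ** finite_subset by blast
  show "{} \<notin> P" "{} \<notin> Q" using * by (auto simp: partition_on_def)
  show ***: "B \<in> P \<Longrightarrow> B \<subseteq> {1..n}" using *(1) by (auto simp: partition_on_def)
  then show "B \<in> P \<Longrightarrow> finite B" using finite_subset by blast
  show "B \<in> P \<Longrightarrow> Suc n \<notin> B" using *** by fastforce
  show "B \<in> P \<Longrightarrow> B \<noteq> {}" using * by (auto simp: partition_on_def)
  show "B \<in> P \<Longrightarrow> C \<in> P \<Longrightarrow> x \<in> B \<Longrightarrow> x \<in> C \<Longrightarrow> B = C"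
    using *(1) by (auto simp: partition_on_def disjoint_def)
qed

lemma extend_in_marked_partitions:
  assumes "(P, Q) \<in> marked_partitions n" "B \<in> insert {} Q"
  shows "(extend (Suc n) B P, extend_marks (Suc n) B b Q) \<in> marked_partitions (Suc n)"
proof -
  note D = marked_partitionsD[OF assms(1)]
  have U: "\<Union> P = {1..n}" using D(1) by (auto simp: partition_on_def)
  have "partition_on {1..Suc n} (extend (Suc n) B P)"
  proof (rule partition_onI)
    have "\<Union> (extend (Suc n) B P) = insert (Suc n) (\<Union> P)"
      using assms(2) D(2) by (auto simp: extend_def)
    then show "\<Union> (extend (Suc n) B P) = {1..Suc n}" using U by auto
  next
    fix p q assume "p \<in> extend (Suc n) B P" "q \<in> extend (Suc n) B P" "p \<noteq> q"
    moreover have "disjnt p q" if "p \<in> P" "q \<in> P" "p \<noteq> q" for p q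
      using D(11)[OF that(1,2)] that(3) by (auto simp: disjnt_def)
    moreover have "disjnt (insert (Suc n) B) p \<and> disjnt p (insert (Suc n) B)" if "p \<in> P - {B}" for p
    proof -
      have "B = {} \<or> B \<in> P" using assms(2) D(2) by blast
      then have "disjnt B p" using D(11)[of B p] that by (auto simp: disjnt_def)
      then show ?thesis using D(9)[of p] that by (auto simp: disjnt_def)
    qed
    ultimately show "disjnt p q" unfolding extend_def by blast
  next
    show "{} \<notin> extend (Suc n) B P" using D(5) by (auto simp: extend_def)
  qed
  moreover have "extend_marks (Suc n) B b Q \<subseteq> extend (Suc n) B P"
    using D(2) by (auto simp: extend_def extend_marks_def)
  ultimately show ?thesis by (simp add: marked_partitions_def)
qed


text \<open>
  Deleting the largest element turns a marked partition into a smaller one in which the block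
  that lost the element, unless it was a singleton, is open again; this inverts the extensions.
\<close>

lemma sum_marked_partitions_Suc:
  "(\<Sum>(P, Q)\<in>marked_partitions (Suc n). f P Q) =
   (\<Sum>(P, Q)\<in>marked_partitions n. \<Sum>B\<in>insert {} Q. \<Sum>b\<in>UNIV.
      f (extend (Suc n) B P) (extend_marks (Suc n) B b Q))"
proof -
  let ?N = "Suc n"
  let ?S = "Sigma (marked_partitions n) (\<lambda>(P, Q). insert {} Q \<times> (UNIV :: bool set))"
  let ?i = "\<lambda>((P, Q), B, b). (extend ?N B P, extend_marks ?N B b Q)"
  define blk where "blk P = (THE B. B \<in> P \<and> ?N \<in> B)" for P :: "nat set set"
  \<comment> \<open>removing \<open>{}\<close> covers the case of \<open>n + 1\<close> forming a singleton\<close>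
  let ?j = "\<lambda>(P, Q). let B = blk P; A = B - {?N} in
     ((insert A (P - {B}) - {{}}, insert A (Q - {B}) - {{}}), A, B \<in> Q)"
  have blk: "blk P = B" if "(P, Q) \<in> marked_partitions ?N" "B \<in> P" "?N \<in> B" for P Q B
    unfolding blk_def
    by (rule the_equality) (use that marked_partitionsD(11)[OF that(1)] in blast)+
  have "(\<Sum>(P, Q)\<in>marked_partitions ?N. f P Q) = (\<Sum>((P, Q), B, b)\<in>?S. f (extend ?N B P) (extend_marks ?N B b Q))"
  proof (rule sum.reindex_bij_witness[where i = ?i and j = ?j])
    fix s assume s: "s \<in> marked_partitions ?N"
    obtain P Q where s_eq: "s = (P, Q)" by force
    note s' = s[unfolded s_eq]
    note D = marked_partitionsD[OF s']
    have U: "\<Union> P = {1..?N}" using D(1) by (auto simp: partition_on_def)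
    then obtain B where B: "B \<in> P" "?N \<in> B" by (metis UnionE atLeastAtMost_iff le_add1 plus_1_eq_Suc order_refl)
    note blk = blk[OF s' B]
    have ins: "insert ?N (B - {?N}) = B" using B by blast
    have nB: "B - {?N} \<notin> P" using D(5) D(11)[OF _ B(1)] B(2) by (metis Diff_iff all_not_in_conv insert_iff)
    have nC: "?N \<notin> C" if "C \<in> P" "C \<noteq> B" for C using D(11)[OF that(1) B(1)] that B(2) by blast
    have 1: "insert B (insert (B - {?N}) (P - {B}) - {{}} - {B - {?N}}) = P"
      using nB B(1) D(5) by blast
    have 2: "insert (B - {?N}) (Q - {B}) - {{}} - {B - {?N}} = Q - {B}"
      using nB D(2,6) by blast
    have 3: "(if B \<in> Q then insert B (Q - {B}) else Q - {B}) = Q" by auto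
    show ij: "?i (?j s) = s"
      by (simp only: s_eq Let_def blk extend_def extend_marks_def ins 1 2 3 case_prod_conv)
    have "partition_on {1..n} (insert (B - {?N}) (P - {B}) - {{}})"
    proof (rule partition_onI)
      have "\<Union> (insert (B - {?N}) (P - {B}) - {{}}) = \<Union> P - {?N}"
        using B nC by auto
      then show "\<Union> (insert (B - {?N}) (P - {B}) - {{}}) = {1..n}" using U by auto
    next
      fix p q assume "p \<in> insert (B - {?N}) (P - {B}) - {{}}" "q \<in> insert (B - {?N}) (P - {B}) - {{}}" "p \<noteq> q"
      moreover have "disjnt p q" if "p \<in> P" "q \<in> P" "p \<noteq> q" for p q
        using D(11)[OF that(1,2)] that(3) by (auto simp: disjnt_def)
      moreover have "disjnt (p - {?N}) q \<and> disjnt q (p - {?N})" if "disjnt p q" for p q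
        using that by (auto simp: disjnt_def)
      ultimately show "disjnt p q" using B(1) by auto
    qed auto
    moreover have "insert (B - {?N}) (Q - {B}) - {{}} \<subseteq> insert (B - {?N}) (P - {B}) - {{}}" using D(2) by blast
    ultimately show "?j s \<in> ?S" 
      by (auto simp: s_eq Let_def blk marked_partitions_def)
    show "(\<lambda>((P, Q), B, b). f (extend ?N B P) (extend_marks ?N B b Q)) (?j s) = (\<lambda>(P, Q). f P Q) s"
      by (simp only: s_eq Let_def blk extend_def extend_marks_def ins 1 2 3 case_prod_conv)
  next
    fix t assume "t \<in> ?S"
    then obtain P Q B b where t: "t = ((P, Q), B, b)" "(P, Q) \<in> marked_partitions n" "B \<in> insert {} Q" by auto
    note D = marked_partitionsD[OF t(2)]
    note ext = extend_in_marked_partitions[OF t(2,3)]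
    show "?i t \<in> marked_partitions ?N" using ext by (simp add: t(1))
    have B: "B = {} \<or> B \<in> P" using t(3) D(2) by blast
    have nB: "?N \<notin> B" using B D(9) by auto
    have "blk (extend ?N B P) = insert ?N B"
      by (rule blk[OF ext]) (auto simp: extend_def)
    moreover have "insert ?N B - {?N} = B" using nB by auto
    moreover have nP: "insert ?N B \<notin> P" using D(9) by blast
    moreover have "insert B (extend ?N B P - {insert ?N B}) - {{}} = P"
      using nP B D(5) by (auto simp: extend_def)
    moreover have "insert B (extend_marks ?N B b Q - {insert ?N B}) - {{}} = Q"
      using nP t(3) D(2,6) by (auto simp: extend_marks_def)
    moreover have "insert ?N B \<in> extend_marks ?N B b Q \<longleftrightarrow> b"
      using nP D(2) by (auto simp: extend_marks_def)
    ultimately show "?j (?i t) = t"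
      by (simp add: t(1) Let_def)
  qed
  also have "\<dots> = (\<Sum>(P, Q)\<in>marked_partitions n. \<Sum>(B, b)\<in>insert {} Q \<times> (UNIV :: bool set).
      f (extend ?N B P) (extend_marks ?N B b Q))"
    by (subst sum.Sigma[symmetric])
      (auto simp: finite_marked_partitions marked_partitionsD case_prod_beta intro!: sum.cong)
  also have "\<dots> = (\<Sum>(P, Q)\<in>marked_partitions n. \<Sum>B\<in>insert {} Q. \<Sum>b\<in>UNIV.
      f (extend ?N B P) (extend_marks ?N B b Q))"
    by (simp add: sum.cartesian_product)
  finally show ?thesis .
qed

lemma arcs_extend:
  assumes "(P, Q) \<in> marked_partitions n" "B \<in> insert {} Q"
  shows "arcs (extend (Suc n) B P) = (if B = {} then arcs P else insert (Max B, Suc n) (arcs P))"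
proof -
  note D = marked_partitionsD[OF assms(1)]
  have B: "B = {} \<or> B \<in> P" using assms(2) D(2) by auto
  have le: "x \<le> n" if "x \<in> C" "C \<in> P" for x C using D(7)[OF that(2)] that(1) by auto
  have "(i, j) \<in> arcs (extend (Suc n) B P) \<longleftrightarrow>
        (i, j) \<in> (if B = {} then arcs P else insert (Max B, Suc n) (arcs P))" for i j
  proof (cases "B = {}")
    case True
    then show ?thesis using D(5) by (auto simp: arcs_def extend_def)
  next
    case False
    then have BP: "B \<in> P" using B by simp
    note fB = D(8)[OF BP]
    from BP have M: "Max B \<in> B" "\<And>x. x \<in> B \<Longrightarrow> x \<le> Max B" "Max B < Suc n"
      using False fB le[OF _ BP] by (auto simp: less_Suc_eq_le)
    moreover have "(i, j) \<in> arcs (extend (Suc n) B P) \<longleftrightarrow>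
       i < j \<and> ((i \<in> insert (Suc n) B \<and> j \<in> insert (Suc n) B \<and> (\<forall>k\<in>insert (Suc n) B. \<not> (i < k \<and> k < j)))
          \<or> (\<exists>C\<in>P - {B}. i \<in> C \<and> j \<in> C \<and> (\<forall>k\<in>C. \<not> (i < k \<and> k < j))))"
      by (auto simp: arcs_def extend_def)
    moreover have "i < j \<and> (i \<in> insert (Suc n) B \<and> j \<in> insert (Suc n) B \<and> (\<forall>k\<in>insert (Suc n) B. \<not> (i < k \<and> k < j)))
      \<longleftrightarrow> (i = Max B \<and> j = Suc n) \<or> i < j \<and> i \<in> B \<and> j \<in> B \<and> (\<forall>k\<in>B. \<not> (i < k \<and> k < j))"
    proof (cases "j = Suc n")
      case True
      have "Suc n \<notin> B" using D(9)[OF BP] .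
      moreover have "i = Max B" if "i \<in> B" "\<forall>k\<in>B. \<not> (i < k \<and> k < Suc n)"
        using M that by (metis le_neq_implies_less)
      moreover have "\<not> (Max B < k \<and> k < Suc n)" if "k \<in> B" for k
        using M(2)[OF that] by simp
      ultimately show ?thesis using True M by auto
    next
      case False
      moreover have "i < j \<Longrightarrow> i = Suc n \<Longrightarrow> j \<notin> B" using le[OF _ BP] by fastforce
      moreover have "j \<in> B \<Longrightarrow> \<not> Suc n < j" using le[OF _ BP] by fastforce
      ultimately show ?thesis by auto
    qed
    moreover have "(\<exists>C\<in>P. R C) \<longleftrightarrow> R B \<or> (\<exists>C\<in>P - {B}. R C)" for R
      using BP by blast
    then have "(i, j) \<in> arcs P \<longleftrightarrow>
       i < j \<and> ((i \<in> B \<and> j \<in> B \<and> (\<forall>k\<in>B. \<not> (i < k \<and> k < j)))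
          \<or> (\<exists>C\<in>P - {B}. i \<in> C \<and> j \<in> C \<and> (\<forall>k\<in>C. \<not> (i < k \<and> k < j))))"
      by (simp only: arcs_def mem_Collect_eq case_prod_conv)
    ultimately have "(i, j) \<in> arcs (extend (Suc n) B P) \<longleftrightarrow> (i = Max B \<and> j = Suc n) \<or> (i, j) \<in> arcs P"
      by (simp only: conj_disj_distribL disj_assoc)
    then show ?thesis using False by simp
  qed
  then show ?thesis by (intro set_eqI) (simp only: split_paired_all)
qed

lemma finite_arcs:
  assumes "partition_on {1..n} P" shows "finite (arcs P)"
proof (rule finite_subset)
  show "arcs P \<subseteq> {1..n} \<times> {1..n}"
    using assms by (auto simp: arcs_def partition_on_def)
qed simp

lemma arcs_le:
  assumes "(P, Q) \<in> marked_partitions n" "(i, j) \<in> arcs P" shows "i < j" "j \<le> n"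
  using assms(2) marked_partitionsD(7)[OF assms(1)] by (fastforce simp: arcs_def)+

text \<open>
  Appending \<open>n + 1\<close> to an open block \<open>B\<close> closes the arc from \<open>Max B\<close>. The pending crossings at \<open>Max B\<close> become
  actual crossings, so their number is unchanged, and the new arc is crossed by
  exactly the pending arcs that start after \<open>Max B\<close>.
\<close>

lemma marked_crossings_extend:
  assumes PQ: "(P, Q) \<in> marked_partitions n" and BQ: "B \<in> insert {} Q"
  shows "marked_crossings (extend (Suc n) B P) (extend_marks (Suc n) B b Q) =
         marked_crossings P Q + later_open Q B"
proof -
  let ?N = "Suc n"
  note D = marked_partitionsD[OF PQ]
  define X where "X A = {(a, a'). a \<in> A \<and> a' \<in> A \<and> fst a < fst a' \<and> fst a' < snd a \<and> snd a < snd a'}"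
    for A :: "(nat \<times> nat) set"
  define Y where "Y A R = {(a, C). a \<in> A \<and> C \<in> R \<and> fst a < Max C \<and> Max C < snd a}"
    for A :: "(nat \<times> nat) set" and R :: "nat set set"
  have mc: "marked_crossings P' Q' = card (X (arcs P')) + card (Y (arcs P') Q')" for P' Q'
    unfolding marked_crossings_def linear_crossings_def open_crossings_def X_def Y_def
    by (intro arg_cong2[where f = "(+)"] arg_cong[where f = card]) auto
  have fA: "finite (arcs P)" using finite_arcs D(1) .
  have arc: "fst a < snd a" "snd a < ?N" if "a \<in> arcs P" for a
    using arcs_le[OF PQ, of "fst a" "snd a"] that by auto
  have fX: "finite (X A)" if "finite A" for A
    by (rule finite_subset[of _ "A \<times> A"]) (use that in \<open>auto simp: X_def\<close>)
  have fY: "finite (Y A R)" if "finite A" "finite R" for A R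
    by (rule finite_subset[of _ "A \<times> R"]) (use that in \<open>auto simp: Y_def\<close>)
  have MN: "Max (insert ?N B) = ?N"
  proof (cases "B = {}")
    case False
    then have BP: "B \<in> P" using BQ D(2) by auto
    then have "Max B \<le> ?N" using D(7,8)[OF BP] False by (metis Max_in atLeastAtMost_iff subsetD le_SucI)
    then show ?thesis using Max_insert[OF D(8)[OF BP] False, of ?N] by (simp only: max_absorb1)
  qed simp
  have new: "Y A (extend_marks ?N B b Q) = Y A (Q - {B})" if "\<And>a. a \<in> A \<Longrightarrow> snd a \<le> ?N" for A
  proof -
    have "\<not> Max (insert ?N B) < snd a" if "a \<in> A" for a
      using \<open>\<And>a. a \<in> A \<Longrightarrow> snd a \<le> ?N\<close>[OF that] by (simp only: MN not_less)
    then show ?thesis by (auto simp only: Y_def extend_marks_def split: if_splits)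
  qed
  show ?thesis
  proof (cases "B = {}")
    case True
    have "Q - {{}} = Q" using D(6) by blast
    then have "Y (arcs P) (extend_marks ?N B b Q) = Y (arcs P) Q"
      using new[of "arcs P"] arc(2) True by (simp add: less_imp_le)
    moreover have "arcs (extend ?N B P) = arcs P" using arcs_extend[OF assms] True by simp
    ultimately show ?thesis using True by (simp add: mc later_open_def)
  next
    case False
    then have BQ': "B \<in> Q" using BQ by simp
    then have BP: "B \<in> P" using D(2) by blast
    let ?c = "(Max B, ?N)" and ?Z = "{a \<in> arcs P. fst a < Max B \<and> Max B < snd a}"
    have fZ: "finite ?Z" using fA by simp
    have arcs': "arcs (extend ?N B P) = insert ?c (arcs P)"
      using arcs_extend[OF assms] False by simp
    have "X (insert ?c (arcs P)) = X (arcs P) \<union> (\<lambda>a. (a, ?c)) ` ?Z"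
    proof -
      have "\<not> ?N < snd a" "\<not> snd a < snd a" if "a \<in> arcs P" for a using arc(2)[OF that] by simp_all
      then show ?thesis using arc(2) by (auto simp: X_def)
    qed
    moreover have "X (arcs P) \<inter> (\<lambda>a. (a, ?c)) ` ?Z = {}"
      by (auto simp: X_def dest: arc)
    moreover have "card ((\<lambda>a. (a, ?c)) ` ?Z) = card ?Z"
      by (rule card_image) (auto simp: inj_on_def)
    ultimately have cX: "card (X (insert ?c (arcs P))) = card (X (arcs P)) + card ?Z"
      using card_Un_disjoint[OF fX[OF fA] finite_imageI[OF fZ]] by simp
    let ?R = "{C \<in> Q. Max B < Max C}"
    have MC: "Max C < ?N" if "C \<in> Q" for C
      using that D(2,7,8,10) by (metis Max_in atLeastAtMost_iff le_imp_less_Suc subsetD)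
    have "Y (insert ?c (arcs P)) (Q - {B}) = Y (arcs P) (Q - {B}) \<union> (\<lambda>C. (?c, C)) ` ?R"
      using MC by (auto simp: Y_def)
    moreover have "Y (arcs P) (Q - {B}) \<inter> (\<lambda>C. (?c, C)) ` ?R = {}"
      by (auto simp: Y_def dest: arc)
    moreover have "card ((\<lambda>C. (?c, C)) ` ?R) = card ?R"
      by (rule card_image) (auto simp: inj_on_def)
    moreover have fYB: "finite (Y (arcs P) (Q - {B}))" using fY fA D(4) by simp
    moreover have "finite ((\<lambda>C. (?c, C)) ` ?R)" using D(4) by simp
    ultimately have cY: "card (Y (insert ?c (arcs P)) (Q - {B})) = card (Y (arcs P) (Q - {B})) + card ?R"
      by (simp add: card_Un_disjoint)
    have "Y (arcs P) Q = Y (arcs P) (Q - {B}) \<union> (\<lambda>a. (a, B)) ` ?Z"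
      using BQ' by (auto simp: Y_def)
    moreover have "Y (arcs P) (Q - {B}) \<inter> (\<lambda>a. (a, B)) ` ?Z = {}"
      by (auto simp: Y_def)
    moreover have "card ((\<lambda>a. (a, B)) ` ?Z) = card ?Z"
      by (rule card_image) (auto simp: inj_on_def)
    ultimately have cQ: "card (Y (arcs P) Q) = card (Y (arcs P) (Q - {B})) + card ?Z"
      using card_Un_disjoint[OF fYB finite_imageI[OF fZ]] by simp
    have "Y (insert ?c (arcs P)) (extend_marks ?N B b Q) = Y (insert ?c (arcs P)) (Q - {B})"
      by (rule new) (auto dest: arc(2))
    then show ?thesis
      using False by (simp add: mc arcs' cX cY cQ later_open_def)
  qed
qed

lemma sum_card_greater:
  fixes S :: "'a :: linorder set"
  assumes "finite S"
  shows "(\<Sum>s\<in>S. g (card {t \<in> S. s < t})) = (\<Sum>i<card S. g i)"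
  using assms
proof (induction rule: finite_linorder_min_induct)
  case (insert b A)
  have 1: "{t \<in> insert b A. s < t} = {t \<in> A. s < t}" if "s \<in> A" for s
    using insert that by auto
  have 2: "{t \<in> insert b A. b < t} = A" using insert by auto
  have 3: "b \<notin> A" using insert by auto
  have "(\<Sum>s\<in>insert b A. g (card {t \<in> insert b A. s < t})) = g (card A) + (\<Sum>s\<in>A. g (card {t \<in> A. s < t}))"
    using insert.hyps(1) 1 2 3 by simp
  then show ?case using insert 3 by (simp add: add.commute)
qed simp

text \<open>
  As \<open>B\<close> runs through the open blocks, the number of new crossings takes each of the values
  \<open>0, ..., card Q - 1\<close> once. This makes the crossings a sum of independent uniform variables once the
  sets of smallest and largest elements of the blocks are given.
\<close>

lemma sum_later_open:
  assumes "(P, Q) \<in> marked_partitions n"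
  shows "(\<Sum>B\<in>Q. g (later_open Q B)) = (\<Sum>i<card Q. g i)"
proof -
  note D = marked_partitionsD[OF assms]
  have inj: "inj_on Max Q"
    using D(2,8,10,11) by (intro inj_onI) (metis Max_in subsetD)
  have "later_open Q B = card {t \<in> Max ` Q. Max B < t}" if "B \<in> Q" for B
  proof -
    have "{t \<in> Max ` Q. Max B < t} = Max ` {C \<in> Q. Max B < Max C}" by auto
    moreover have "inj_on Max {C \<in> Q. Max B < Max C}" using inj by (rule inj_on_subset) auto
    moreover have "B \<noteq> {}" using that D(6) by auto
    ultimately show ?thesis by (simp add: later_open_def card_image)
  qed
  then have "(\<Sum>B\<in>Q. g (later_open Q B)) = (\<Sum>t\<in>Max ` Q. g (card {t' \<in> Max ` Q. t < t'}))"
    by (simp add: sum.reindex[OF inj])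
  also have "\<dots> = (\<Sum>i<card Q. g i)"
    using D(4) by (subst sum_card_greater) (simp_all add: card_image[OF inj])
  finally show ?thesis .
qed

section \<open>Generating polynomials of the binomial moments\<close>

lemma sum_choose_shift:
  "(\<Sum>i<h. real ((x + i) choose 0)) = real h"
  "2 * (\<Sum>i<h. real ((x + i) choose 1)) = 2 * real h * real (x choose 1) + real h * (real h - 1)"
  "6 * (\<Sum>i<h. real ((x + i) choose 2)) =
     6 * real h * real (x choose 2) + 3 * real (x choose 1) * real h * (real h - 1) + real h * (real h - 1) * (real h - 2)"
proof -
  have e: "2 * real (k choose 2) = real k * (real k - 1)" for k
    by (induction k) (auto simp: numeral_2_eq_2 algebra_simps)
  show "(\<Sum>i<h. real ((x + i) choose 0)) = real h" by simp
  show "2 * (\<Sum>i<h. real ((x + i) choose 1)) = 2 * real h * real (x choose 1) + real h * (real h - 1)"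
    by (induction h) (auto simp: algebra_simps)
  have "2 * (\<Sum>i<h. 2 * real ((x + i) choose 2) * 3) =
     2 * (6 * real h * real (x choose 2) + 3 * real x * real h * (real h - 1) + real h * (real h - 1) * (real h - 2))"
    unfolding e using e[of x] by (induction h) (auto simp: algebra_simps)
  then show "6 * (\<Sum>i<h. real ((x + i) choose 2)) =
     6 * real h * real (x choose 2) + 3 * real (x choose 1) * real h * (real h - 1) + real h * (real h - 1) * (real h - 2)"
    by (simp add: sum_distrib_left[symmetric] sum_distrib_right[symmetric])
qed

text \<open>
  The four summands belong to the new element being a singleton, opening a block,
  continuing a block, and ending a block.
\<close>

lemma sum_crossings_open_Suc:
  fixes f :: "nat \<Rightarrow> nat \<Rightarrow> 'a :: comm_monoid_add"
  shows "(\<Sum>(P, Q)\<in>marked_partitions (Suc n). f (marked_crossings P Q) (card Q)) =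
   (\<Sum>(P, Q)\<in>marked_partitions n. f (marked_crossings P Q) (card Q) + f (marked_crossings P Q) (Suc (card Q))
      + (\<Sum>i<card Q. f (marked_crossings P Q + i) (card Q) + f (marked_crossings P Q + i) (card Q - 1)))"
  unfolding sum_marked_partitions_Suc
proof (intro sum.cong refl, clarify)
  fix P Q assume PQ: "(P, Q) \<in> marked_partitions n"
  note D = marked_partitionsD[OF PQ]
  let ?N = "Suc n"
  let ?g = "\<lambda>B b. f (marked_crossings (extend ?N B P) (extend_marks ?N B b Q)) (card (extend_marks ?N B b Q))"
  have nN: "insert ?N B \<notin> Q" for B using D(2,9) by auto
  have e: "Q - {{}} = Q" using D(6) by blast
  have 0: "?g {} False = f (marked_crossings P Q) (card Q)" "?g {} True = f (marked_crossings P Q) (Suc (card Q))"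
    using D(4) nN unfolding marked_crossings_extend[OF PQ insertI1] by (simp_all add: later_open_def extend_marks_def e)
  have 1: "?g B False + ?g B True = f (marked_crossings P Q + later_open Q B) (card Q) + f (marked_crossings P Q + later_open Q B) (card Q - 1)"
    if "B \<in> Q" for B
  proof -
    have "Suc (card Q - Suc 0) = card Q" using that D(4) by (metis One_nat_def Suc_pred card_gt_0_iff empty_iff)
    then show ?thesis
      using D(4) nN that unfolding marked_crossings_extend[OF PQ insertI2[OF that]]
      by (simp add: extend_marks_def add.commute)
  qed
  have "(\<Sum>B\<in>insert {} Q. \<Sum>b\<in>UNIV. ?g B b) = (?g {} False + ?g {} True) + (\<Sum>B\<in>Q. ?g B False + ?g B True)"
    using D(4,6) by (simp add: UNIV_bool add.commute)
  also have "(\<Sum>B\<in>Q. ?g B False + ?g B True) = (\<Sum>B\<in>Q. f (marked_crossings P Q + later_open Q B) (card Q) + f (marked_crossings P Q + later_open Q B) (card Q - 1))"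
    by (intro sum.cong refl 1)
  also have "\<dots> = (\<Sum>i<card Q. f (marked_crossings P Q + i) (card Q) + f (marked_crossings P Q + i) (card Q - 1))"
    by (rule sum_later_open[OF PQ])
  finally show "(\<Sum>B\<in>insert {} Q. \<Sum>b\<in>UNIV. ?g B b) = f (marked_crossings P Q) (card Q) + f (marked_crossings P Q) (Suc (card Q))
      + (\<Sum>i<card Q. f (marked_crossings P Q + i) (card Q) + f (marked_crossings P Q + i) (card Q - 1))"
    unfolding 0 .
qed

text \<open>
  These are the generating polynomials of the binomial moments of the number of crossings, in which the
  variable marks the open blocks; the constant coefficient belongs to ordinary partitions.
\<close>

definition crossing_poly :: "nat \<Rightarrow> nat \<Rightarrow> real poly" where
  "crossing_poly k n = (\<Sum>(P, Q)\<in>marked_partitions n. monom (real (marked_crossings P Q choose k)) (card Q))"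

definition Y :: "real poly" where "Y = [:1, 1:]"

lemma pderiv_Y: "pderiv Y = 1" by (simp add: Y_def pderiv_pCons)

lemma X_eq: "[:0, 1:] = Y - 1" by (simp add: Y_def one_pCons)


lemma crossing_poly_step:
  fixes x h :: nat
  defines "m k \<equiv> monom (real (x choose k)) h"
  defines "s k \<equiv> monom (real (x choose k)) h + monom (real (x choose k)) (Suc h) +
    (\<Sum>i<h. monom (real ((x + i) choose k)) h + monom (real ((x + i) choose k)) (h - 1))"
  shows "s 0 = Y * (m 0 + pderiv (m 0))"
    "2 * s 1 = Y * (2 * (m 1 + pderiv (m 1)) + [:0, 1:] * pderiv (pderiv (m 0)))"
    "6 * s 2 = Y * (6 * (m 2 + pderiv (m 2)) + 3 * [:0, 1:] * pderiv (pderiv (m 1))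
       + [:0, 1:] ^ 2 * pderiv (pderiv (pderiv (m 0))))"
proof -
  define S where "S k = (\<Sum>i<h. real ((x + i) choose k))" for k
  have s: "poly (s k) z = real (x choose k) * z ^ h + real (x choose k) * z ^ Suc h + S k * z ^ h + S k * z ^ (h - 1)" for k z
    by (simp add: s_def poly_sum poly_monom sum.distrib S_def sum_distrib_right)
  have S: "S 0 = real h" "S 1 = (2 * real h * real (x choose 1) + real h * (real h - 1)) / 2"
    "S 2 = (6 * real h * real (x choose 2) + 3 * real (x choose 1) * real h * (real h - 1) + real h * (real h - 1) * (real h - 2)) / 6"
    using sum_choose_shift[of x h] unfolding S_def by simp_all
  consider "h = 0" | "h = 1" | "h = 2" | k where "h = Suc (Suc (Suc k))"
    by (metis One_nat_def Suc_1 not0_implies_Suc)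
  note cases = this
  have p: "p = q" if "\<And>z. poly p z = poly q z" for p q :: "real poly"
    using that by (simp add: poly_eq_poly_eq_iff[symmetric] fun_eq_iff)
  show "s 0 = Y * (m 0 + pderiv (m 0))"
    by (rule p, rule cases) (simp_all add: s S m_def pderiv_monom poly_monom Y_def algebra_simps power2_eq_square power3_eq_cube)
  show "2 * s 1 = Y * (2 * (m 1 + pderiv (m 1)) + [:0, 1:] * pderiv (pderiv (m 0)))"
    by (rule p, rule cases) (simp_all add: s S[unfolded One_nat_def] m_def pderiv_monom poly_monom Y_def field_simps power2_eq_square power3_eq_cube)
  show "6 * s 2 = Y * (6 * (m 2 + pderiv (m 2)) + 3 * [:0, 1:] * pderiv (pderiv (m 1))
       + [:0, 1:] ^ 2 * pderiv (pderiv (pderiv (m 0))))"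
    by (rule p, rule cases) (simp_all add: s S[unfolded One_nat_def] m_def pderiv_monom poly_monom Y_def field_simps power2_eq_square power3_eq_cube)
qed

lemma pderiv_sum_set: "pderiv (\<Sum>x\<in>A. f x) = (\<Sum>x\<in>A. pderiv (f x))"
  by (induction A rule: infinite_finite_induct) (simp_all add: pderiv_add)

text \<open>
  With $q$ marking the crossings, one step is the operator $(1 + x)(1 + D_q)$ for the $q$-derivative $D_q$.
  The three recurrences are the coefficients of its expansion at $q = 1$, where
  $D_q = D + (q - 1) x D^2 / 2 + (q - 1)^2 x^2 D^3 / 6 + \dots$
\<close>

lemma crossing_poly_Suc:
  "crossing_poly 0 (Suc n) = Y * (crossing_poly 0 n + pderiv (crossing_poly 0 n))"
  "2 * crossing_poly 1 (Suc n) = Y * (2 * (crossing_poly 1 n + pderiv (crossing_poly 1 n))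
     + [:0, 1:] * pderiv (pderiv (crossing_poly 0 n)))"
  "6 * crossing_poly 2 (Suc n) = Y * (6 * (crossing_poly 2 n + pderiv (crossing_poly 2 n))
     + 3 * [:0, 1:] * pderiv (pderiv (crossing_poly 1 n))
     + [:0, 1:] ^ 2 * pderiv (pderiv (pderiv (crossing_poly 0 n))))"
  unfolding crossing_poly_def sum_crossings_open_Suc[where f = "\<lambda>x h. monom (real (x choose k)) h" for k]
  by (simp_all only: pderiv_sum_set sum_distrib_left sum.distrib[symmetric] case_prod_unfold crossing_poly_step[unfolded One_nat_def] One_nat_def)

abbreviation touchard :: "nat \<Rightarrow> real poly" where "touchard n \<equiv> crossing_poly 0 n"

text \<open>
  In terms of $Y = 1 + x$ this is the derivation $Y\,d/dY$. It maps the span of the Touchard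
  polynomials over the polynomials in $Y$ to itself, which is why closed forms exist in this span and
  why they can be checked by rewriting.
\<close>

definition euler_op :: "real poly \<Rightarrow> real poly" where "euler_op p = Y * pderiv p"

lemma pderiv_of_nat [simp]: "pderiv (of_nat n) = (0 :: real poly)"
  by (simp add: of_nat_poly pderiv_pCons)

lemma euler_op_simps:
  "euler_op (p + q) = euler_op p + euler_op q"
  "euler_op (p - q) = euler_op p - euler_op q"
  "euler_op (p * q) = p * euler_op q + q * euler_op p"
  "euler_op (numeral k) = 0"
  "euler_op (of_nat n) = 0"
  "euler_op 1 = 0" "euler_op 0 = 0"
  "euler_op Y = Y"
  "euler_op (touchard n) = touchard (Suc n) - Y * touchard n"
  by (simp_all add: euler_op_def pderiv_add pderiv_diff pderiv_mult crossing_poly_Suc algebra_simps pderiv_Y)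

lemma euler_op_power: "euler_op (p ^ k) = of_nat k * p ^ (k - 1) * euler_op p"
  by (induction k) (auto simp: euler_op_simps algebra_simps power_eq_if)

lemma euler_op_pderiv:
  "Y ^ 2 * pderiv (pderiv p) = euler_op (euler_op p) - euler_op p"
  "Y ^ 3 * pderiv (pderiv (pderiv p)) = euler_op (euler_op (euler_op p)) - 3 * euler_op (euler_op p) + 2 * euler_op p"
  by (simp_all add: euler_op_def pderiv_mult pderiv_add pderiv_Y algebra_simps power2_eq_square power3_eq_cube)


lemma marked_partitions_0: "marked_partitions 0 = {({}, {})}"
  by (auto simp: marked_partitions_def partition_on_empty)

lemma touchard_small:
  "touchard 0 = 1" "touchard (Suc 0) = Y" "touchard (Suc (Suc 0)) = Y + Y ^ 2"
  "touchard (Suc (Suc (Suc 0))) = Y + 3 * Y ^ 2 + Y ^ 3"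
  "touchard (Suc (Suc (Suc (Suc 0)))) = Y + 7 * Y ^ 2 + 6 * Y ^ 3 + Y ^ 4"
proof -
  have rec: "touchard (Suc n) = Y * touchard n + euler_op (touchard n)" for n
    by (simp add: euler_op_simps)
  show 0: "touchard 0 = 1" by (simp add: crossing_poly_def marked_partitions_0)
  show 1: "touchard (Suc 0) = Y" unfolding rec 0 by (simp add: euler_op_simps)
  show 2: "touchard (Suc (Suc 0)) = Y + Y ^ 2"
    unfolding rec[of "Suc 0"] 1 by (simp add: euler_op_simps power2_eq_square)
  show 3: "touchard (Suc (Suc (Suc 0))) = Y + 3 * Y ^ 2 + Y ^ 3"
    unfolding rec[of "Suc (Suc 0)"] 2 by (simp add: euler_op_simps power2_eq_square power3_eq_cube algebra_simps)
  show "touchard (Suc (Suc (Suc (Suc 0)))) = Y + 7 * Y ^ 2 + 6 * Y ^ 3 + Y ^ 4"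
    unfolding rec[of "Suc (Suc (Suc 0))"] 3
    by (simp add: euler_op_simps power2_eq_square power3_eq_cube power4_eq_xxxx algebra_simps)
qed

lemma crossing_poly_0: "k > 0 \<Longrightarrow> crossing_poly k 0 = 0"
  by (simp add: crossing_poly_def marked_partitions_0 marked_crossings_def linear_crossings_def open_crossings_def arcs_def case_prod_unfold)

text \<open>
  The functions $Y^m e^{-Y}$ are eigenfunctions of the unperturbed step $p \mapsto Y (p + p')$ with eigenvalue $m$,
  and the perturbation maps each of them to a combination of its neighbours. The closed form comes from
  this expansion, where the sum over the position of the perturbation is geometric.
\<close>

lemma crossing_poly_1_closed:
  "4 * Y * crossing_poly 1 n = (2 * touchard (n + 1) + (- 2) * touchard (n + 2))
     + Y * ((2 * of_nat n) * touchard n + (3 + 2 * of_nat n) * touchard (n + 1) + (- 3) * touchard (n + 2))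
     + Y ^ 2 * (2 * touchard n + 4 * touchard (n + 1))
     + Y ^ 3 * ((- 1) * touchard n)"
  (is "_ = ?G n")
proof (induction n)
  case 0
  show ?case by (simp add: crossing_poly_0 touchard_small eval_nat_numeral algebra_simps)
next
  case (Suc n)
  let ?U = "4 * Y * crossing_poly 1 n"
  have "4 * Y * crossing_poly 1 (Suc n) = 2 * Y * (2 * crossing_poly 1 (Suc n))" by simp
  also have "\<dots> = 4 * (Y ^ 2) * crossing_poly 1 n + 4 * Y * (Y * pderiv (crossing_poly 1 n))
     + 2 * (Y - 1) * (Y ^ 2 * pderiv (pderiv (touchard n)))"
    unfolding crossing_poly_Suc X_eq by (simp add: algebra_simps power2_eq_square)
  also have "\<dots> = Y * ?U + euler_op ?U - ?U + 2 * (Y - 1) * (euler_op (euler_op (touchard n)) - euler_op (touchard n))"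
    unfolding euler_op_pderiv by (simp add: euler_op_simps euler_op_def[of "crossing_poly _ _"] algebra_simps power2_eq_square)
  also have "\<dots> = ?G (Suc n)"
    unfolding Suc.IH by (simp add: euler_op_simps algebra_simps power2_eq_square power3_eq_cube)
  finally show ?case .
qed

text \<open>
  Found in the same way, with two perturbations; the sums over their positions are divided differences
  of $z \mapsto z^n$, which accounts for the quadratic dependence on $n$.
\<close>

lemma crossing_poly_2_closed:
  "288 * Y ^ 2 * crossing_poly 2 n = ((- 24) * touchard (n + 1) + 108 * touchard (n + 2) + (- 120) * touchard (n + 3) + 36 * touchard (n + 4))
     + Y * (((- 48) + 72 * of_nat n) * touchard (n + 1) + 108 * touchard (n + 2) + ((- 168) + (- 72) * of_nat n) * touchard (n + 3) + 108 * touchard (n + 4))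
     + Y ^ 2 * (((- 84) * of_nat n + 36 * of_nat n ^ 2) * touchard n + ((- 314) + (- 252) * of_nat n + 72 * of_nat n ^ 2) * touchard (n + 1) + (255 + 12 * of_nat n + 36 * of_nat n ^ 2) * touchard (n + 2) + ((- 310) + (- 108) * of_nat n) * touchard (n + 3) + 81 * touchard (n + 4))
     + Y ^ 3 * (((- 168) + 72 * of_nat n) * touchard n + ((- 360) + 216 * of_nat n) * touchard (n + 1) + (144 * of_nat n) * touchard (n + 2) + (- 216) * touchard (n + 3))
     + Y ^ 4 * ((168 + (- 36) * of_nat n) * touchard n + (234 + (- 36) * of_nat n) * touchard (n + 1) + 198 * touchard (n + 2))
     + Y ^ 5 * ((- 68) * touchard n + (- 72) * touchard (n + 1))
     + Y ^ 6 * (9 * touchard n)"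
  (is "_ = ?G n")
proof (induction n)
  case 0
  show ?case by (simp add: crossing_poly_0 touchard_small eval_nat_numeral algebra_simps)
next
  case (Suc n)
  let ?U = "4 * Y * crossing_poly 1 n" and ?V = "288 * Y ^ 2 * crossing_poly 2 n"
  let ?t = "touchard n"
  have e2: "euler_op (Y ^ 2) = 2 * Y ^ 2" by (simp add: power2_eq_square euler_op_simps)
  have "288 * Y ^ 2 * crossing_poly 2 (Suc n) = 48 * Y ^ 2 * (6 * crossing_poly 2 (Suc n))" by simp
  also have "\<dots> = 288 * Y * Y ^ 2 * crossing_poly 2 n + 288 * Y ^ 2 * (Y * pderiv (crossing_poly 2 n))
     + 144 * (Y - 1) * Y * (Y ^ 2 * pderiv (pderiv (crossing_poly 1 n)))
     + 48 * (Y - 1) ^ 2 * (Y ^ 3 * pderiv (pderiv (pderiv (touchard n))))"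
    unfolding crossing_poly_Suc X_eq by (simp add: algebra_simps power2_eq_square power3_eq_cube)
  also have "\<dots> = Y * ?V + euler_op ?V - 2 * ?V
     + 36 * (Y - 1) * (euler_op (euler_op ?U) - 3 * euler_op ?U + 2 * ?U)
     + 48 * (Y - 1) ^ 2 * (euler_op (euler_op (euler_op ?t)) - 3 * euler_op (euler_op ?t) + 2 * euler_op ?t)"
    unfolding euler_op_pderiv by (simp add: euler_op_simps e2 euler_op_def[of "crossing_poly 2 _"] algebra_simps)
  also have "\<dots> = ?G (Suc n)"
    unfolding Suc.IH crossing_poly_1_closed
    by (simp add: euler_op_simps euler_op_power algebra_simps eval_nat_numeral)
  finally show ?case .
qed

section \<open>Bell numbers and the exact variance\<close>

lemma sums_euler:
  fixes f :: "real \<Rightarrow> real"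
  assumes "\<And>z. (\<lambda>m. c m * z ^ m) sums f z"
  shows "(\<lambda>m. (real m * c m) * z ^ m) sums (z * deriv f z)"
proof -
  have f: "f z = (\<Sum>m. c m * z ^ m)" for z using assms sums_unique by blast
  have sm: "summable (\<lambda>m. c m * z ^ m)" for z using assms sums_summable by blast
  have D: "(f has_field_derivative (\<Sum>m. diffs c m * z ^ m)) (at z)"
    using termdiffs_strong_converges_everywhere[OF sm] unfolding f[abs_def] .
  have "(\<lambda>m. diffs c m * z ^ m) sums deriv f z"
    using termdiff_converges_all[OF sm] DERIV_imp_deriv[OF D] by (simp add: summable_sums)
  from sums_mult[OF this, of z] have "(\<lambda>m. real (Suc m) * c (Suc m) * z ^ Suc m) sums (z * deriv f z)"
    by (simp add: diffs_def algebra_simps)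
  then show "(\<lambda>m. (real m * c m) * z ^ m) sums (z * deriv f z)"
    using sums_Suc[of "\<lambda>m. (real m * c m) * z ^ m"] by simp
qed

text \<open>
  The Dobinski formula with a parameter: both sides satisfy the recurrence of the Touchard polynomials.
\<close>

lemma touchard_sums:
  "(\<lambda>m. (real m ^ n / fact m) * (1 + x) ^ m) sums (poly (touchard n) x * exp (1 + x))"
proof (induction n arbitrary: x)
  case 0
  show ?case using exp_converges[of "1 + x"] by (simp add: touchard_small(1) divide_inverse mult.commute scaleR_conv_of_real)
next
  case (Suc n)
  define f where "f z = poly (touchard n) (z - 1) * exp z" for z
  have sm: "(\<lambda>m. (real m ^ n / fact m) * z ^ m) sums f z" for z
    using Suc.IH[of "z - 1"] by (simp add: f_def)
  have "(f has_field_derivative (poly (pderiv (touchard n)) (z - 1) * exp z + poly (touchard n) (z - 1) * exp z)) (at z)" for z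
    unfolding f_def by (auto intro!: derivative_eq_intros)
  then have d: "deriv f z = (poly (pderiv (touchard n)) (z - 1) + poly (touchard n) (z - 1)) * exp z" for z
    by (metis DERIV_imp_deriv distrib_right)
  show ?case
    using sums_euler[OF sm, of "1 + x"] unfolding d crossing_poly_Suc
    by (simp add: Y_def algebra_simps)
qed

text \<open>
  At $x = 0$ only the marked partitions without open blocks survive.
\<close>

lemma poly_crossing_poly_at_0:
  "poly (crossing_poly k n) 0 = (\<Sum>P\<in>set_partitions n. real (linear_crossings P choose k))"
proof -
  have "poly (crossing_poly k n) 0 = (\<Sum>(P, Q)\<in>marked_partitions n. if Q = {} then real (marked_crossings P Q choose k) else 0)"
    unfolding crossing_poly_def poly_sum
    by (intro sum.cong refl) (auto simp: poly_monom power_0_left marked_partitionsD(4) split: if_splits)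
  also have "\<dots> = (\<Sum>(P, Q)\<in>(\<lambda>P. (P, {})) ` set_partitions n. real (marked_crossings P Q choose k))"
    by (intro sum.mono_neutral_cong_right finite_marked_partitions)
      (auto simp: marked_partitions_def set_partitions_def)
  also have "\<dots> = (\<Sum>P\<in>set_partitions n. real (linear_crossings P choose k))"
    by (subst sum.reindex) (auto simp: inj_on_def marked_crossings_def open_crossings_def)
  finally show ?thesis .
qed

text \<open>
  Since $X^2 = 2 \binom X2 + X$, the two closed forms at $Y = 1$ are enough. The values of the Touchard
  polynomials there are the Bell numbers.
\<close>

lemma variance_crossings_exact:
  fixes n :: nat
  defines "b j \<equiv> poly (touchard j) 0"
  defines "\<mu> j \<equiv> b (n + j) / b n"
  shows "144 * measure_pmf.variance (random_partition n) (\<lambda>P. real (linear_crossings P)) =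
    225 * \<mu> 4 - (180 * real n + 814) * \<mu> 3 + (36 * real n ^ 2 + 156 * real n + 489) * \<mu> 2
    + (72 * real n ^ 2 + 72 * real n - 260) * \<mu> 1 + (36 * real n ^ 2 + 24 * real n - 23)
    - 9 * ((2 * real n + 9) * \<mu> 1 - 5 * \<mu> 2 + 2 * real n + 1) ^ 2"
proof -
  let ?X = "\<lambda>P. real (linear_crossings P)"
  have b: "b n = real (card (set_partitions n))"
    by (simp add: b_def poly_crossing_poly_at_0)
  have b0: "b n > 0" unfolding b using finite_set_partitions set_partitions_nonempty by (simp add: card_gt_0_iff)
  have E: "measure_pmf.expectation (random_partition n) f = (\<Sum>P\<in>set_partitions n. f P) / b n" for f :: "_ \<Rightarrow> real"
    unfolding random_partition_def b
    by (simp add: integral_pmf_of_set set_partitions_nonempty finite_set_partitions)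
  have int: "integrable (measure_pmf (random_partition n)) f" for f :: "_ \<Rightarrow> real"
    unfolding random_partition_def
    by (rule integrable_measure_pmf_finite) (simp add: set_partitions_nonempty finite_set_partitions)
  have sq: "real x ^ 2 = 2 * real (x choose 2) + real (x choose 1)" for x
    by (induction x) (auto simp: numeral_2_eq_2 algebra_simps)
  have "measure_pmf.variance (random_partition n) ?X
      = measure_pmf.expectation (random_partition n) (\<lambda>P. ?X P ^ 2) - measure_pmf.expectation (random_partition n) ?X ^ 2"
    by (rule measure_pmf.variance_eq[OF int int])
  also have "\<dots> = (2 * poly (crossing_poly 2 n) 0 + poly (crossing_poly 1 n) 0) / b n - (poly (crossing_poly 1 n) 0 / b n) ^ 2"
    unfolding E sq poly_crossing_poly_at_0 by (simp add: sum.distrib sum_distrib_left)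
  finally have V: "measure_pmf.variance (random_partition n) ?X =
    2 * (poly (crossing_poly 2 n) 0 / b n) + poly (crossing_poly 1 n) 0 / b n - (poly (crossing_poly 1 n) 0 / b n) ^ 2"
    by (simp add: add_divide_distrib)
  have p1: "4 * poly (crossing_poly 1 n) 0 = (2 * real n + 9) * b (n + 1) - 5 * b (n + 2) + (2 * real n + 1) * b n"
    using arg_cong[OF crossing_poly_1_closed[of n], of "\<lambda>p. poly p 0"]
    by (simp add: Y_def b_def algebra_simps)
  have p2: "288 * poly (crossing_poly 2 n) 0 = 225 * b (n + 4) - (180 * real n + 814) * b (n + 3)
    + (36 * real n ^ 2 + 156 * real n + 669) * b (n + 2) + (72 * real n ^ 2 - 584) * b (n + 1)
    + (36 * real n ^ 2 - 48 * real n - 59) * b n"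
    using arg_cong[OF crossing_poly_2_closed[of n], of "\<lambda>p. poly p 0"]
    by (simp add: Y_def b_def algebra_simps)
  have bm: "b (n + j) = \<mu> j * b n" for j using b0 by (simp add: \<mu>_def)
  have q1: "poly (crossing_poly 1 n) 0 / b n = ((2 * real n + 9) * \<mu> 1 - 5 * \<mu> 2 + (2 * real n + 1)) / 4"
  proof -
    have "poly (crossing_poly 1 n) 0 = ((2 * real n + 9) * \<mu> 1 - 5 * \<mu> 2 + (2 * real n + 1)) / 4 * b n"
      using p1 unfolding bm by (simp add: algebra_simps)
    then show ?thesis using b0 by simp
  qed
  have q2: "poly (crossing_poly 2 n) 0 / b n = (225 * \<mu> 4 - (180 * real n + 814) * \<mu> 3
    + (36 * real n ^ 2 + 156 * real n + 669) * \<mu> 2 + (72 * real n ^ 2 - 584) * \<mu> 1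
    + (36 * real n ^ 2 - 48 * real n - 59)) / 288"
  proof -
    have "288 * poly (crossing_poly 2 n) 0 = (225 * \<mu> 4 - (180 * real n + 814) * \<mu> 3
    + (36 * real n ^ 2 + 156 * real n + 669) * \<mu> 2 + (72 * real n ^ 2 - 584) * \<mu> 1
    + (36 * real n ^ 2 - 48 * real n - 59)) * b n"
      using p2 unfolding bm by (simp add: algebra_simps)
    moreover have "p / y = x / 288" if "288 * p = x * y" "y > 0" for p x y :: real
      using that by (simp add: field_simps)
    ultimately show ?thesis using b0 by blast
  qed
  show ?thesis unfolding V q1 q2 by (simp add: field_simps power2_eq_square)
qed

section \<open>Expectations under Dobinski weights\<close>

definition weight :: "nat \<Rightarrow> nat \<Rightarrow> real" where
  "weight n m = real m ^ n / fact m"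

definition total_weight :: "nat \<Rightarrow> real" where
  "total_weight n = (\<Sum>m. weight n m)"

text \<open>
  The expectation of $g(M)$ for a random number $M$ with probabilities proportional to $m^n / m!$.
  By the Dobinski formula its moments are ratios of Bell numbers. The expectations below are all
  taken of polynomially bounded functions, for which the series converges absolutely.
\<close>

definition mean :: "nat \<Rightarrow> (nat \<Rightarrow> real) \<Rightarrow> real" where
  "mean n g = (\<Sum>m. weight n m * g m) / total_weight n"

definition poly_bounded :: "(nat \<Rightarrow> real) \<Rightarrow> bool" where
  "poly_bounded g \<longleftrightarrow> (\<exists>C k. \<forall>m. \<bar>g m\<bar> \<le> C * real (Suc m) ^ k)"


lemma poly_boundedI: "(\<And>m. \<bar>g m\<bar> \<le> C * real (Suc m) ^ k) \<Longrightarrow> poly_bounded g"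
  unfolding poly_bounded_def by blast

lemma poly_bounded_const [intro, simp]: "poly_bounded (\<lambda>_. c)"
  by (rule poly_boundedI[of _ "\<bar>c\<bar>" 0]) simp

lemma poly_bounded_id [intro, simp]: "poly_bounded real"
  by (rule poly_boundedI[of _ 1 1]) simp

lemma poly_bounded_mono:
  assumes "poly_bounded f" "\<And>m. \<bar>g m\<bar> \<le> \<bar>f m\<bar>" shows "poly_bounded g"
  using assms unfolding poly_bounded_def by (meson order_trans)

lemma poly_bounded_add [intro, simp]:
  assumes "poly_bounded f" "poly_bounded g" shows "poly_bounded (\<lambda>m. f m + g m)"
proof -
  obtain C k D l where *: "\<And>m. \<bar>f m\<bar> \<le> C * real (Suc m) ^ k" "\<And>m. \<bar>g m\<bar> \<le> D * real (Suc m) ^ l"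
    using assms unfolding poly_bounded_def by blast
  have CD: "0 \<le> C" "0 \<le> D" using *(1)[of 0] *(2)[of 0] by auto
  show ?thesis
  proof (rule poly_boundedI[of _ "C + D" "k + l"])
    fix m
    have "real (Suc m) ^ k \<le> real (Suc m) ^ (k + l)" "real (Suc m) ^ l \<le> real (Suc m) ^ (k + l)"
      by (rule power_increasing; simp)+
    then have "C * real (Suc m) ^ k \<le> C * real (Suc m) ^ (k + l)" "D * real (Suc m) ^ l \<le> D * real (Suc m) ^ (k + l)"
      using CD by (auto intro: mult_left_mono)
    then show "\<bar>f m + g m\<bar> \<le> (C + D) * real (Suc m) ^ (k + l)"
      using *(1)[of m] *(2)[of m] unfolding distrib_right by linarith
  qed
qed

lemma poly_bounded_mult [intro, simp]:
  assumes "poly_bounded f" "poly_bounded g" shows "poly_bounded (\<lambda>m. f m * g m)"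
proof -
  obtain C k D l where *: "\<And>m. \<bar>f m\<bar> \<le> C * real (Suc m) ^ k" "\<And>m. \<bar>g m\<bar> \<le> D * real (Suc m) ^ l"
    using assms unfolding poly_bounded_def by blast
  show ?thesis
  proof (rule poly_boundedI[of _ "C * D" "k + l"])
    fix m
    have "\<bar>f m\<bar> * \<bar>g m\<bar> \<le> (C * real (Suc m) ^ k) * (D * real (Suc m) ^ l)"
      using *(1)[of m] *(2)[of m] by (intro mult_mono) (auto intro: order_trans[OF abs_ge_zero])
    then show "\<bar>f m * g m\<bar> \<le> C * D * real (Suc m) ^ (k + l)"
      by (simp add: abs_mult power_add algebra_simps)
  qed
qed

lemma poly_bounded_minus [intro, simp]:
  assumes "poly_bounded f" shows "poly_bounded (\<lambda>m. - f m)"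
  by (rule poly_bounded_mono[OF assms]) simp

lemma poly_bounded_diff [intro, simp]:
  assumes "poly_bounded f" "poly_bounded g" shows "poly_bounded (\<lambda>m. f m - g m)"
  using poly_bounded_add[OF assms(1) poly_bounded_minus[OF assms(2)]] by simp

lemma poly_bounded_power [intro, simp]:
  assumes "poly_bounded f" shows "poly_bounded (\<lambda>m. f m ^ k)"
  by (induction k) (use assms in auto)

lemma poly_bounded_divide [simp]: "poly_bounded f \<Longrightarrow> poly_bounded (\<lambda>m. f m / c)"
  using poly_bounded_mult[of f "\<lambda>_. inverse c"] by (simp add: divide_inverse)

lemma poly_bounded_if [intro, simp]:
  assumes "poly_bounded f" shows "poly_bounded (\<lambda>m. if Q m then f m else 0)"
  by (rule poly_bounded_mono[OF assms]) simp

lemma poly_bounded_pred [intro]: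
  assumes "poly_bounded g" shows "poly_bounded (\<lambda>m. g (m - 1))"
proof -
  obtain C k where *: "\<And>m. \<bar>g m\<bar> \<le> C * real (Suc m) ^ k"
    using assms unfolding poly_bounded_def by blast
  have "0 \<le> C" using *[of 0] by auto
  show ?thesis
  proof (rule poly_boundedI[of _ C k])
    fix m
    have "C * real (Suc (m - 1)) ^ k \<le> C * real (Suc m) ^ k"
      using \<open>0 \<le> C\<close> by (intro mult_left_mono power_mono) auto
    then show "\<bar>g (m - 1)\<bar> \<le> C * real (Suc m) ^ k" using *[of "m - 1"] by linarith
  qed
qed

lemma summable_weight_power: "summable (\<lambda>m. real (Suc m) ^ k / fact m)"
proof (rule summable_comparison_test)
  have *: "real (Suc m) ^ k \<le> fact k * exp 1 * exp 1 ^ m" for m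
  proof -
    have "real (Suc m) ^ k / fact k \<le> exp (real (Suc m))"
    proof -
      have "real (Suc m) ^ k / fact k \<le> (\<Sum>i. real (Suc m) ^ i /\<^sub>R fact i)"
        using sum_le_suminf[OF summable_exp_generic[of "real (Suc m)"], of "{k}"]
        by (simp add: divide_inverse mult.commute)
      then show ?thesis by (simp add: exp_def)
    qed
    then show ?thesis by (simp add: exp_add exp_of_nat_mult divide_simps mult.commute mult.left_commute flip: exp_of_nat_mult)
  qed
  show "\<exists>N. \<forall>m\<ge>N. norm (real (Suc m) ^ k / fact m) \<le> fact k * exp 1 * (exp 1 ^ m / fact m)"
    using * by (auto simp: divide_right_mono simp del: of_nat_Suc)
  show "summable (\<lambda>m. fact k * exp 1 * (exp 1 ^ m / fact m) :: real)"
    using summable_exp_generic[of "exp 1 :: real"] by (intro summable_mult) (simp add: divide_inverse mult.commute)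
qed

lemma weight_nonneg [simp]: "0 \<le> weight n m"
  by (simp add: weight_def)

lemma summable_weight: 
  assumes "poly_bounded g" shows "summable (\<lambda>m. weight n m * g m)"
proof -
  obtain C k where *: "\<And>m. \<bar>g m\<bar> \<le> C * real (Suc m) ^ k"
    using assms unfolding poly_bounded_def by blast
  show ?thesis
  proof (rule summable_comparison_test)
    have "\<bar>weight n m * g m\<bar> \<le> C * (real (Suc m) ^ (n + k) / fact m)" for m
    proof -
      have "weight n m * \<bar>g m\<bar> \<le> (real (Suc m) ^ n / fact m) * (C * real (Suc m) ^ k)"
        using *[of m] unfolding weight_def by (intro mult_mono divide_right_mono power_mono) auto
      then show ?thesis by (simp add: abs_mult power_add algebra_simps)
    qed
    then show "\<exists>N. \<forall>m\<ge>N. norm (weight n m * g m) \<le> C * (real (Suc m) ^ (n + k) / fact m)" by auto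
    show "summable (\<lambda>m. C * (real (Suc m) ^ (n + k) / fact m))"
      by (intro summable_mult summable_weight_power)
  qed
qed

lemma total_weight_pos: "total_weight n > 0"
proof -
  have "weight n 1 \<le> (\<Sum>m. weight n m)"
    using sum_le_suminf[OF summable_weight[of "\<lambda>_. 1"], of "{1}"] by simp
  then show ?thesis by (simp add: weight_def total_weight_def)
qed

lemma mean_add: "poly_bounded f \<Longrightarrow> poly_bounded g \<Longrightarrow> mean n (\<lambda>m. f m + g m) = mean n f + mean n g"
  using suminf_add[OF summable_weight summable_weight, of f g n n]
  by (simp add: mean_def distrib_left add_divide_distrib[symmetric])

lemma mean_diff: "poly_bounded f \<Longrightarrow> poly_bounded g \<Longrightarrow> mean n (\<lambda>m. f m - g m) = mean n f - mean n g"
  using suminf_diff[OF summable_weight summable_weight, of f g n n]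
  by (simp add: mean_def right_diff_distrib diff_divide_distrib[symmetric])

lemma mean_cmult: "poly_bounded f \<Longrightarrow> mean n (\<lambda>m. c * f m) = c * mean n f"
  using suminf_mult[OF summable_weight, of f c n]
  by (simp add: mean_def mult.left_commute)

lemma mean_const [simp]: "mean n (\<lambda>_. c) = c"
proof -
  have "summable (weight n)" using summable_weight[of "\<lambda>_. 1" n] by simp
  from suminf_mult2[OF this, of c] have "(\<Sum>m. weight n m * c) = total_weight n * c"
    by (simp add: total_weight_def)
  then show ?thesis using total_weight_pos[of n] by (simp add: mean_def)
qed

lemma mean_mono:
  assumes "poly_bounded f" "poly_bounded g" "\<And>m. m > 0 \<Longrightarrow> f m \<le> g m" "n > 0"
  shows "mean n f \<le> mean n g"
proof -
  have "weight n m * f m \<le> weight n m * g m" for m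
    using assms(3)[of m] assms(4) by (cases "m = 0") (auto simp: weight_def power_0_left intro: divide_right_mono mult_left_mono)
  then show ?thesis
    unfolding mean_def using total_weight_pos[of n]
    by (intro divide_right_mono suminf_le summable_weight assms) auto
qed

text \<open>
  The ratio of the weights of $m + 1$ and $m$ is $(1 + 1/m)^n / (m + 1)$. So the law of $M$ is the stationary
  law of the birth-death chain with birth rate $(1 + 1/m)^n$ and death rate $m$.
\<close>

definition birth_rate :: "nat \<Rightarrow> real \<Rightarrow> real" where
  "birth_rate n x = (1 + 1 / x) ^ n"

lemma poly_bounded_birth_rate [simp]: "poly_bounded (\<lambda>m. birth_rate n (real m))"
proof (rule poly_boundedI[of _ "2 ^ n" 0])
  fix m :: nat
  have "(1 + 1 / real m) ^ n \<le> 2 ^ n"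
  proof (cases "m = 0")
    case False
    then have "1 + 1 / real m \<le> 2" by (simp add: field_simps)
    then show ?thesis by (intro power_mono) auto
  qed simp
  then show "\<bar>birth_rate n (real m)\<bar> \<le> 2 ^ n * real (Suc m) ^ 0" by (simp add: birth_rate_def)
qed

text \<open>
  Shifting the summation index. The boundary term appears since no weight sits at $0$,
  while a birth from $0$ would have to be counted.
\<close>

lemma mean_birth_rate:
  assumes "n > 0" "poly_bounded g"
  shows "mean n (\<lambda>m. birth_rate n (real m) * g m) = mean n (\<lambda>m. real m * g (m - 1)) - g 0 / total_weight n"
proof -
  have s: "summable (\<lambda>m. weight n m * (birth_rate n (real m) * g m))" (is "summable ?f")
    by (intro summable_weight poly_bounded_mult poly_bounded_birth_rate assms)
  have "(\<Sum>m. weight n m * (real m * g (m - 1))) = (\<Sum>m. weight n (Suc m) * (real (Suc m) * g m))"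
    using suminf_split_head[of "\<lambda>m. weight n m * (real m * g (m - 1))"] summable_weight[of "\<lambda>m. real m * g (m - 1)" n]
      poly_bounded_pred[OF assms(2)] by (simp del: of_nat_Suc)
  also have "\<dots> = (\<Sum>m. ?f m + (if m = 0 then g 0 else 0))"
  proof (rule suminf_cong)
    fix m
    have f: "fact (Suc m) = real (Suc m) * fact m" by simp
    have "weight n (Suc m) * (real (Suc m) * g m) = real (Suc m) ^ n / fact m * g m"
      unfolding weight_def f by (simp del: of_nat_Suc)
    also have "\<dots> = ?f m + (if m = 0 then g 0 else 0)"
    proof (cases "m = 0")
      case False
      then have "real m * (1 + 1 / real m) = real (Suc m)" by (simp add: field_simps)
      then show ?thesis using False
        by (simp add: weight_def birth_rate_def power_mult_distrib[symmetric] del: of_nat_Suc)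
    qed (use assms(1) in \<open>simp add: weight_def\<close>)
    finally show "weight n (Suc m) * (real (Suc m) * g m) = ?f m + (if m = 0 then g 0 else 0)" .
  qed
  also have "\<dots> = (\<Sum>m. ?f m) + g 0"
  proof -
    have "(\<lambda>m. if m = 0 then g 0 else 0) sums g 0" using sums_single[of 0 "\<lambda>_. g 0"] by simp
    then show ?thesis using suminf_add[OF s, of "\<lambda>m. if m = 0 then g 0 else 0"]
      by (simp add: sums_iff)
  qed
  finally show ?thesis by (simp add: mean_def add_divide_distrib)
qed

lemma birth_rate_antimono: "0 < x \<Longrightarrow> x \<le> y \<Longrightarrow> birth_rate n y \<le> birth_rate n x"
  unfolding birth_rate_def by (intro power_mono) (auto simp: field_simps)

lemma birth_rate_nonneg: "0 < x \<Longrightarrow> 0 \<le> birth_rate n x"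
  by (simp add: birth_rate_def)

lemma birth_rate_exp:
  assumes "x > 0"
  shows "exp (real n / (x + 1)) \<le> birth_rate n x" "birth_rate n x \<le> exp (real n / x)"
proof -
  have "exp (1 / (x + 1)) \<le> 1 + 1 / x"
  proof -
    have "x / (x + 1) = 1 + - (1 / (x + 1))" using assms by (simp add: field_simps)
    also have "\<dots> \<le> exp (- (1 / (x + 1)))" by (rule exp_ge_add_one_self)
    finally have "x / (x + 1) \<le> inverse (exp (1 / (x + 1)))" by (simp add: exp_minus)
    then have "exp (1 / (x + 1)) \<le> inverse (x / (x + 1))"
      using assms by (metis add_pos_pos divide_pos_pos exp_gt_zero inverse_inverse_eq le_imp_inverse_le zero_less_one)
    then show ?thesis using assms by (simp add: field_simps)
  qed
  then have "exp (1 / (x + 1)) ^ n \<le> birth_rate n x"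
    unfolding birth_rate_def by (intro power_mono) auto
  then show "exp (real n / (x + 1)) \<le> birth_rate n x"
    by (simp add: exp_of_nat_mult[symmetric])
  have "birth_rate n x \<le> exp (1 / x) ^ n"
    unfolding birth_rate_def using assms by (intro power_mono exp_ge_add_one_self) auto
  then show "birth_rate n x \<le> exp (real n / x)"
    by (simp add: exp_of_nat_mult[symmetric])
qed

lemma birth_rate_slope_upper:
  assumes "0 < b" "b \<le> x" "x \<le> y"
  shows "birth_rate n x - birth_rate n y \<le> real n / b ^ 2 * exp (real n / b) * (y - x)"
proof -
  let ?\<kappa> = "real n / b ^ 2 * exp (real n / b)"
  have "birth_rate n x + ?\<kappa> * x \<le> birth_rate n y + ?\<kappa> * y"
  proof (rule DERIV_nonneg_imp_nondecreasing[OF assms(3)])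
    fix z assume z: "x \<le> z" "z \<le> y"
    then have z0: "0 < z" "b \<le> z" using assms by auto
    have "((\<lambda>z. birth_rate n z + ?\<kappa> * z) has_real_derivative
        (real n * (1 + 1 / z) ^ (n - 1) * (- 1 / z ^ 2) + ?\<kappa>)) (at z)"
      unfolding birth_rate_def using z0 assms(1)
      by (auto intro!: derivative_eq_intros simp: power2_eq_square)
    moreover have "real n * (1 + 1 / z) ^ (n - 1) * (1 / z ^ 2) \<le> ?\<kappa>"
    proof -
      have "(1 + 1 / z) ^ (n - 1) \<le> (1 + 1 / z) ^ n" using z0 by (intro power_increasing) auto
      also have "\<dots> \<le> exp (real n / b)"
        using birth_rate_antimono[of b z n] birth_rate_exp(2)[of b n] assms(1) z0 by (simp add: birth_rate_def)
      finally have 1: "(1 + 1 / z) ^ (n - 1) \<le> exp (real n / b)" .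
      have "b ^ 2 \<le> z ^ 2" "0 < b ^ 2" using z0 assms(1) by (auto intro: power_mono)
      then have "1 / z ^ 2 \<le> 1 / b ^ 2" by (simp add: frac_le)
      with 1 have "(1 + 1 / z) ^ (n - 1) * (1 / z ^ 2) \<le> exp (real n / b) * (1 / b ^ 2)"
        by (intro mult_mono) auto
      then show ?thesis using mult_left_mono[of _ _ "real n"] by (fastforce simp: algebra_simps)
    qed
    ultimately show "\<exists>D. ((\<lambda>z. birth_rate n z + ?\<kappa> * z) has_real_derivative D) (at z) \<and> 0 \<le> D"
      by (intro exI conjI) auto
  qed
  then show ?thesis unfolding right_diff_distrib by linarith
qed

lemma birth_rate_slope_lower:
  assumes "0 < x" "x \<le> y" "y \<le> b" "n > 0"
  shows "real n / (b * (b + 1)) * exp (real n / (b + 1)) * (y - x) \<le> birth_rate n x - birth_rate n y"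
proof -
  let ?\<kappa> = "real n / (b * (b + 1)) * exp (real n / (b + 1))"
  have b: "0 < b" using assms by auto
  have "birth_rate n y + ?\<kappa> * y \<le> birth_rate n x + ?\<kappa> * x"
  proof (rule DERIV_nonpos_imp_nonincreasing[OF assms(2)])
    fix z assume z: "x \<le> z" "z \<le> y"
    then have z0: "0 < z" "z \<le> b" using assms by auto
    have "((\<lambda>z. birth_rate n z + ?\<kappa> * z) has_real_derivative
        (real n * (1 + 1 / z) ^ (n - 1) * (- 1 / z ^ 2) + ?\<kappa>)) (at z)"
      unfolding birth_rate_def using z0 by (auto intro!: derivative_eq_intros simp: power2_eq_square)
    moreover have "?\<kappa> \<le> real n * (1 + 1 / z) ^ (n - 1) * (1 / z ^ 2)"
    proof -
      have "(1 + 1 / z) ^ (n - 1) * (1 / z ^ 2) = birth_rate n z * (1 / (z * (z + 1)))"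
      proof -
        have "birth_rate n z = (1 + 1 / z) ^ (n - 1) * ((z + 1) / z)"
          using z0 assms(4) by (cases n) (auto simp: birth_rate_def add_divide_distrib)
        then show ?thesis using z0 by (simp add: power2_eq_square)
      qed
      moreover have "exp (real n / (b + 1)) * (1 / (b * (b + 1))) \<le> birth_rate n z * (1 / (z * (z + 1)))"
      proof (rule mult_mono)
        show "exp (real n / (b + 1)) \<le> birth_rate n z"
          using birth_rate_exp(1)[OF b, of n] birth_rate_antimono[of z b n] z0 by linarith
        show "1 / (b * (b + 1)) \<le> 1 / (z * (z + 1))"
          using z0 b by (intro divide_left_mono mult_mono) auto
        show "0 \<le> 1 / (b * (b + 1))" using b by simp
      qed (use z0 birth_rate_nonneg in auto)
      ultimately have "exp (real n / (b + 1)) * (1 / (b * (b + 1))) \<le> (1 + 1 / z) ^ (n - 1) * (1 / z ^ 2)" by simp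
      from mult_left_mono[OF this, of "real n"] show ?thesis by (simp add: algebra_simps)
    qed
    ultimately show "\<exists>D. ((\<lambda>z. birth_rate n z + ?\<kappa> * z) has_real_derivative D) (at z) \<and> D \<le> 0"
      by (intro exI conjI) auto
  qed
  then show ?thesis unfolding right_diff_distrib by linarith
qed

section \<open>Concentration under Dobinski weights\<close>

text \<open>
  The Stein identity of the law of $M$. Everything about $M$ follows from it by choosing $g$: the drift
  $M - \lambda(M)$ is increasing in $M$, and its slope controls the spread of $M$.
\<close>

lemma mean_stein:
  assumes "n > 0" "poly_bounded g"
  shows "mean n (\<lambda>m. (real m - birth_rate n (real m)) * g m)
       = mean n (\<lambda>m. real m * (g m - g (m - 1))) + g 0 / total_weight n"
proof -
  have pb: "poly_bounded (\<lambda>m. g (m - 1))" using assms(2) by (rule poly_bounded_pred)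
  show ?thesis
    unfolding left_diff_distrib right_diff_distrib
    using assms pb by (simp add: mean_diff mean_birth_rate)
qed

lemma mean_power2_le:
  assumes "poly_bounded f" "n > 0" shows "(mean n f) ^ 2 \<le> mean n (\<lambda>m. f m ^ 2)"
proof -
  have "mean n (\<lambda>_. 0) \<le> mean n (\<lambda>m. (f m - mean n f) ^ 2)"
    by (rule mean_mono) (use assms in auto)
  also have "(\<lambda>m. (f m - mean n f) ^ 2) = (\<lambda>m. f m ^ 2 - 2 * mean n f * f m + (mean n f) ^ 2)"
    by (rule ext) (simp add: power2_eq_square algebra_simps)
  also have "mean n \<dots> = mean n (\<lambda>m. f m ^ 2) - (mean n f) ^ 2"
    using assms(1) by (simp add: mean_add mean_diff mean_cmult power2_eq_square)
  finally show ?thesis by simp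
qed

context
  fixes n :: nat and c :: real
  assumes n: "n > 0" and c1: "c \<ge> 1" and fix_c: "birth_rate n c = c"
begin

text \<open>
  The birth rate decreases and equals $c$ at $c$, so it pulls towards $c$ on both sides.
\<close>

lemma drift_ge:
  assumes "m > 0" shows "(real m - c) ^ 2 \<le> (real m - birth_rate n (real m)) * (real m - c)"
proof -
  have "0 \<le> (c - birth_rate n (real m)) * (real m - c)"
  proof (cases "real m \<le> c")
    case True
    then have "c \<le> birth_rate n (real m)" using birth_rate_antimono[of "real m" c n] assms fix_c by simp
    then show ?thesis using True by (intro mult_nonpos_nonpos) auto
  next
    case False
    then have "birth_rate n (real m) \<le> c" using birth_rate_antimono[of c "real m" n] c1 fix_c by simp
    then show ?thesis using False by (intro mult_nonneg_nonneg) auto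
  qed
  then show ?thesis by (simp add: power2_eq_square algebra_simps)
qed

lemma mean_drift: "mean n (\<lambda>m. (real m - birth_rate n (real m)) * (real m - c)) \<le> mean n real"
proof -
  have "(\<lambda>m. real m * ((real m - c) - (real (m - 1) - c))) = real"
  proof
    fix m show "real m * ((real m - c) - (real (m - 1) - c)) = real m" by (cases m) auto
  qed
  moreover have "(real 0 - c) / total_weight n \<le> 0"
    using c1 total_weight_pos[of n] by (intro divide_nonpos_pos) auto
  ultimately show ?thesis
    using mean_stein[OF n, of "\<lambda>m. real m - c"] by simp
qed

lemma mean_dev: "mean n (\<lambda>m. real m - c) = mean n real - c"
  by (simp add: mean_diff)

text \<open>
  The slope of the drift is at least $1$, so the Stein identity for $m - c$ bounds the second moment
  about $c$ by the mean. Both bounds follow, since the mean is $c$ up to the root of this moment.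
\<close>

lemma mean_dev2: "mean n (\<lambda>m. (real m - c) ^ 2) \<le> 3 * c"
  and mean_near: "\<bar>mean n real - c\<bar> \<le> 2 * sqrt c"
proof -
  define a e where "a = mean n (\<lambda>m. (real m - c) ^ 2)" and "e = mean n real - c"
  have "a \<le> mean n (\<lambda>m. (real m - birth_rate n (real m)) * (real m - c))"
    unfolding a_def by (rule mean_mono) (auto intro: drift_ge n)
  then have 1: "a \<le> c + e" using mean_drift by (simp add: e_def)
  have 2: "e ^ 2 \<le> a" using mean_power2_le[of "\<lambda>m. real m - c" n] n by (simp add: mean_dev a_def e_def)
  have "0 \<le> (e - 1) ^ 2" by simp
  then have "2 * e \<le> e ^ 2 + 1" by (simp add: power2_eq_square algebra_simps)
  with 1 2 have 3: "a \<le> 3 * c" using c1 by linarith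
  then show "mean n (\<lambda>m. (real m - c) ^ 2) \<le> 3 * c" by (simp add: a_def)
  have "e ^ 2 \<le> (2 * sqrt c) ^ 2" using 2 3 c1 by simp
  then have "\<bar>e\<bar> \<le> \<bar>2 * sqrt c\<bar>" by (simp only: abs_le_square_iff)
  then show "\<bar>mean n real - c\<bar> \<le> 2 * sqrt c" using c1 by (simp add: e_def)
qed

text \<open>
  The Stein identity for $(m - c)^3$. The cubic term that it produces is absorbed
  into half of the fourth moment.
\<close>

lemma mean_dev4: "mean n (\<lambda>m. (real m - c) ^ 4) \<le> 45 * c ^ 2"
proof -
  let ?d = "\<lambda>m. real m - c"
  have "mean n (\<lambda>m. ?d m ^ 4) \<le> mean n (\<lambda>m. (real m - birth_rate n (real m)) * ?d m ^ 3)"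
  proof (rule mean_mono)
    fix m :: nat assume "m > 0"
    from mult_right_mono[OF drift_ge[OF this] zero_le_power2[of "?d m"]]
    show "?d m ^ 4 \<le> (real m - birth_rate n (real m)) * ?d m ^ 3"
      by (simp only: power4_eq_xxxx power3_eq_cube power2_eq_square mult.assoc)
  qed (auto intro: n)
  also have "\<dots> \<le> mean n (\<lambda>m. real m * (?d m ^ 3 - (real (m - 1) - c) ^ 3))"
  proof -
    have "(0 - c) ^ 3 / total_weight n \<le> 0"
      using c1 total_weight_pos[of n] by (intro divide_nonpos_pos) (auto simp: power3_eq_cube)
    then show ?thesis using mean_stein[OF n, of "\<lambda>m. ?d m ^ 3"] by simp
  qed
  also have "\<dots> \<le> mean n (\<lambda>m. 1 / 2 * ?d m ^ 4 + ((9 / 2 * c + 2) * ?d m ^ 2 + (5 / 2 * c + 1 / 2)))"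
  proof (rule mean_mono)
    fix m :: nat assume m: "m > 0"
    let ?x = "?d m"
    have e: "real m * (?x ^ 3 - (real (m - 1) - c) ^ 3) = (c + ?x) * (3 * ?x ^ 2 - 3 * ?x + 1)"
      using m by (cases m) (auto simp: eval_nat_numeral algebra_simps)
    \<comment> \<open>three squares: their sum is the difference of the two sides\<close>
    have "0 \<le> ?x ^ 2 * (?x - 3) ^ 2 / 2" by simp
    moreover have "0 \<le> 3 / 2 * c * (?x + 1) ^ 2" using c1 by simp
    moreover have "0 \<le> (?x - 1) ^ 2 / 2" by simp
    ultimately show "real m * (?x ^ 3 - (real (m - 1) - c) ^ 3)
        \<le> 1 / 2 * ?x ^ 4 + ((9 / 2 * c + 2) * ?x ^ 2 + (5 / 2 * c + 1 / 2))"
      unfolding e by (simp add: eval_nat_numeral field_simps)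
  next
    have "poly_bounded (\<lambda>m. ?d (m - 1))" by (rule poly_bounded_pred[of ?d]) simp
    then show "poly_bounded (\<lambda>m. real m * (?d m ^ 3 - (real (m - 1) - c) ^ 3))" by simp
  qed (auto intro: n)
  also have "\<dots> = 1 / 2 * mean n (\<lambda>m. ?d m ^ 4) + ((9 / 2 * c + 2) * mean n (\<lambda>m. ?d m ^ 2) + (5 / 2 * c + 1 / 2))"
    by (subst mean_add | subst mean_cmult | simp)+
  finally have "mean n (\<lambda>m. ?d m ^ 4) \<le> (9 * c + 4) * mean n (\<lambda>m. ?d m ^ 2) + (5 * c + 1)"
    by (simp add: algebra_simps)
  also have "(9 * c + 4) * mean n (\<lambda>m. ?d m ^ 2) \<le> (9 * c + 4) * (3 * c)"
    using mean_dev2 c1 by (intro mult_left_mono) auto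
  also have "(9 * c + 4) * (3 * c) + (5 * c + 1) \<le> 45 * c ^ 2"
  proof -
    have "c \<le> c * c" using mult_right_mono[of 1 c c] c1 by simp
    moreover have "(9 * c + 4) * (3 * c) + (5 * c + 1) = 27 * (c * c) + 17 * c + 1"
      by (simp add: algebra_simps)
    ultimately show ?thesis using c1 power2_eq_square[of c] by linarith
  qed
  finally show ?thesis by simp
qed

text \<open>
  Up to $c + L$ the drift has slope at least $1 + \kappa$, which improves the trivial slope $1$. Beyond that
  point the loss is paid for by the fourth moment.
\<close>

lemma mean_dev2_upper:
  assumes L: "L > 0" and \<kappa>0: "0 \<le> \<kappa>"
    and \<kappa>: "\<kappa> \<le> real n / ((c + L) * (c + L + 1)) * exp (real n / (c + L + 1))"
  shows "(1 + \<kappa>) * mean n (\<lambda>m. (real m - c) ^ 2) \<le> mean n real + \<kappa> * (45 * c ^ 2 / L ^ 2)"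
proof -
  let ?d = "\<lambda>m. real m - c"
  have slope: "\<kappa> * (y - x) \<le> birth_rate n x - birth_rate n y" if "0 < x" "x \<le> y" "y \<le> c + L" for x y
    using birth_rate_slope_lower[OF that n] mult_right_mono[OF \<kappa>, of "y - x"] that by linarith
  have "(1 + \<kappa>) * mean n (\<lambda>m. ?d m ^ 2) = mean n (\<lambda>m. (1 + \<kappa>) * ?d m ^ 2)"
    by (simp add: mean_cmult)
  also have "\<dots> \<le> mean n (\<lambda>m. (real m - birth_rate n (real m)) * ?d m + \<kappa> / L ^ 2 * ?d m ^ 4)"
  proof (rule mean_mono)
    fix m :: nat assume m: "m > 0"
    show "(1 + \<kappa>) * ?d m ^ 2 \<le> (real m - birth_rate n (real m)) * ?d m + \<kappa> / L ^ 2 * ?d m ^ 4"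
    proof (cases "real m \<le> c + L")
      case True
      have "\<kappa> * ?d m ^ 2 \<le> (c - birth_rate n (real m)) * ?d m"
      proof (cases "real m \<le> c")
        case True
        have "\<kappa> * (c - real m) \<le> birth_rate n (real m) - c"
          using slope[of "real m" c] m True L fix_c by simp
        from mult_right_mono[OF this, of "c - real m"] True show ?thesis
          by (simp add: power2_eq_square algebra_simps)
      next
        case False
        have "\<kappa> * (real m - c) \<le> c - birth_rate n (real m)"
          using slope[of c "real m"] c1 \<open>real m \<le> c + L\<close> False fix_c by simp
        from mult_right_mono[OF this, of "real m - c"] False show ?thesis
          by (simp add: power2_eq_square algebra_simps)
      qed
      moreover have "0 \<le> \<kappa> / L ^ 2 * ?d m ^ 4" using \<kappa>0 by simp
      ultimately show ?thesis by (simp add: power2_eq_square algebra_simps)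
    next
      case False
      then have "L ^ 2 \<le> ?d m ^ 2" using L by (intro power_mono) auto
      then have "?d m ^ 2 * L ^ 2 \<le> ?d m ^ 2 * ?d m ^ 2" by (intro mult_left_mono) auto
      then have "?d m ^ 2 \<le> ?d m ^ 4 / L ^ 2" using L by (simp add: field_simps eval_nat_numeral)
      from mult_left_mono[OF this \<kappa>0] drift_ge[OF m] show ?thesis by (simp add: algebra_simps)
    qed
  qed (auto intro: n)
  also have "\<dots> = mean n (\<lambda>m. (real m - birth_rate n (real m)) * ?d m) + \<kappa> / L ^ 2 * mean n (\<lambda>m. ?d m ^ 4)"
    by (subst mean_add | subst mean_cmult | simp)+
  also have "\<dots> \<le> mean n real + \<kappa> / L ^ 2 * (45 * c ^ 2)"
    using mean_drift mean_dev4 \<kappa>0 by (intro add_mono mult_left_mono) auto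
  finally show ?thesis by simp
qed

text \<open>
  Here the mean has to be the centre, since a deviation of the mean from $c$ would enter the variance.
  Above $B$ the birth rate has slope at most $\kappa$. Below $B$ it may be exponentially large in $n$, but one more shift
  of the index trades the birth rate for the death rate, which is at most $c$ there.
\<close>

lemma variance_lower:
  assumes L: "L \<ge> 2 * sqrt c + 1" and B: "B = c - 2 * L" "B > 0"
    and \<kappa>: "real n / B ^ 2 * exp (real n / B) \<le> \<kappa>"
  shows "mean n real \<le> (1 + \<kappa>) * mean n (\<lambda>m. (real m - mean n real) ^ 2) + 90 * c ^ 3 / L ^ 3"
proof -
  define \<mu> where "\<mu> = mean n real"
  have slope: "birth_rate n x - birth_rate n y \<le> \<kappa> * (y - x)" if "B \<le> x" "x \<le> y" for x y
    using birth_rate_slope_upper[OF B(2) that, of n] mult_right_mono[OF \<kappa>, of "y - x"] that by linarith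
  have \<kappa>0: "0 \<le> \<kappa>" using order_trans[OF _ \<kappa>] by simp
  have \<mu>: "\<bar>\<mu> - c\<bar> \<le> L - 1" using mean_near L by (simp add: \<mu>_def)
  have L1: "L \<ge> 1" using L c1 by (smt (verit) real_sqrt_ge_zero)
  have B\<mu>: "B \<le> \<mu>" "\<mu> > 0" using \<mu> B L1 by auto
  \<comment> \<open>the part of the test function where the birth rate is out of control\<close>
  define h where "h m = (if real m < B then \<mu> - real m else 0)" for m
  have pbh: "poly_bounded h" unfolding h_def by simp
  have "mean n (\<lambda>m. (real m - birth_rate n (real m)) * (real m - \<mu>)) \<le>
     mean n (\<lambda>m. ((1 + \<kappa>) * (real m - \<mu>) ^ 2 + (\<mu> - birth_rate n \<mu>) * (real m - \<mu>)) + birth_rate n (real m) * h m)"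
  proof (rule mean_mono)
    fix m :: nat assume m: "m > 0"
    have "(birth_rate n \<mu> - birth_rate n (real m)) * (real m - \<mu>) \<le> \<kappa> * (real m - \<mu>) ^ 2 + birth_rate n (real m) * h m"
    proof (cases "real m < B")
      case True
      have "0 \<le> birth_rate n \<mu> * (\<mu> - real m)"
        using True B\<mu> birth_rate_nonneg[of \<mu> n] by (intro mult_nonneg_nonneg) auto
      moreover have "0 \<le> \<kappa> * (real m - \<mu>) ^ 2" using \<kappa>0 by simp
      ultimately show ?thesis using True by (simp add: h_def algebra_simps)
    next
      case False
      show ?thesis
      proof (cases "real m \<le> \<mu>")
        case True
        have "birth_rate n (real m) - birth_rate n \<mu> \<le> \<kappa> * (\<mu> - real m)"
          using slope[of "real m" \<mu>] True False by simp
        from mult_right_mono[OF this, of "\<mu> - real m"] True False show ?thesis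
          by (simp add: h_def power2_eq_square algebra_simps)
      next
        case F: False
        have "birth_rate n \<mu> - birth_rate n (real m) \<le> \<kappa> * (real m - \<mu>)"
          using slope[of \<mu> "real m"] B\<mu> F by simp
        from mult_right_mono[OF this, of "real m - \<mu>"] F False show ?thesis
          by (simp add: h_def power2_eq_square algebra_simps)
      qed
    qed
    then show "(real m - birth_rate n (real m)) * (real m - \<mu>) \<le>
      ((1 + \<kappa>) * (real m - \<mu>) ^ 2 + (\<mu> - birth_rate n \<mu>) * (real m - \<mu>)) + birth_rate n (real m) * h m"
      by (simp add: power2_eq_square algebra_simps)
  qed (use pbh n in auto)
  also have "\<dots> = (1 + \<kappa>) * mean n (\<lambda>m. (real m - \<mu>) ^ 2) + (\<mu> - birth_rate n \<mu>) * mean n (\<lambda>m. real m - \<mu>)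
     + mean n (\<lambda>m. birth_rate n (real m) * h m)"
    using pbh by (simp add: mean_add mean_cmult)
  also have "mean n (\<lambda>m. real m - \<mu>) = 0" by (simp add: mean_diff \<mu>_def)
  also have "mean n (\<lambda>m. birth_rate n (real m) * h m) = mean n (\<lambda>m. real m * h (m - 1)) - \<mu> / total_weight n"
    using mean_birth_rate[OF n pbh] B(2) by (simp add: h_def)
  also have "mean n (\<lambda>m. real m * h (m - 1)) \<le> mean n (\<lambda>m. 2 * c / L ^ 3 * (real m - c) ^ 4)"
  proof (rule mean_mono)
    fix m :: nat assume m: "m > 0"
    show "real m * h (m - 1) \<le> 2 * c / L ^ 3 * (real m - c) ^ 4"
    proof (cases "real (m - 1) < B")
      case True
      define x where "x = c - real m"
      have x: "L \<le> x" using True m B L1 by (simp add: x_def)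
      have "h (m - 1) \<le> 2 * x" using True m \<mu> x by (simp add: h_def x_def)
      moreover have "real m \<le> c" using x L1 by (simp add: x_def)
      ultimately have "real m * h (m - 1) \<le> c * (2 * x)" using x L1 c1 True B\<mu>
        by (intro mult_mono) (auto simp: h_def)
      also have "\<dots> \<le> c * (2 * (x ^ 4 / L ^ 3))"
      proof -
        have "L ^ 3 \<le> x ^ 3" using x L1 by (intro power_mono) auto
        then have "x * L ^ 3 \<le> x * x ^ 3" using x L1 by (intro mult_left_mono) auto
        then have "x \<le> x ^ 4 / L ^ 3" using L1 by (simp add: field_simps eval_nat_numeral)
        then show ?thesis using c1 by (intro mult_left_mono) auto
      qed
      also have "\<dots> = 2 * c / L ^ 3 * (real m - c) ^ 4" 
      proof -
        have "real m - c = - x" by (simp add: x_def)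
        then show ?thesis by simp
      qed
      finally show ?thesis .
    next
      case False
      then show ?thesis using c1 L1 by (simp add: h_def)
    qed
  qed (use pbh n poly_bounded_pred[OF pbh] in auto)
  also have "\<dots> = 2 * c / L ^ 3 * mean n (\<lambda>m. (real m - c) ^ 4)"
    by (rule mean_cmult) simp
  also have "\<dots> \<le> 2 * c / L ^ 3 * (45 * c ^ 2)" using mean_dev4 c1 L1 by (intro mult_left_mono) auto
  finally have "mean n (\<lambda>m. (real m - birth_rate n (real m)) * (real m - \<mu>))
     \<le> (1 + \<kappa>) * mean n (\<lambda>m. (real m - \<mu>) ^ 2) + 90 * c ^ 3 / L ^ 3 - \<mu> / total_weight n"
    by (simp add: eval_nat_numeral)
  moreover have "mean n (\<lambda>m. (real m - birth_rate n (real m)) * (real m - \<mu>)) = \<mu> - \<mu> / total_weight n"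
  proof -
    have "(\<lambda>m. real m * ((real m - \<mu>) - (real (m - 1) - \<mu>))) = real"
    proof
      fix m show "real m * ((real m - \<mu>) - (real (m - 1) - \<mu>)) = real m" by (cases m) auto
    qed
    then show ?thesis using mean_stein[OF n, of "\<lambda>m. real m - \<mu>"] by (simp add: \<mu>_def)
  qed
  ultimately show ?thesis by (simp add: \<mu>_def)
qed

end

text \<open>
  The bounds say that $n / c$ is nearly $\ln c$, that is, $c$ is about $n / W(n)$ for the Lambert function $W$.
\<close>

lemma birth_rate_fixed_point:
  assumes "n > 0"
  obtains c where "c \<ge> 1" "birth_rate n c = c" "c * ln c \<le> real n" "real n \<le> (c + 1) * ln c"
proof -
  have "\<exists>c. 1 \<le> c \<and> c \<le> 3 * real n \<and> c - birth_rate n c = 0"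
  proof (rule IVT')
    show "1 - birth_rate n 1 \<le> 0" by (simp add: birth_rate_def)
    show "1 \<le> 3 * real n" using assms by simp
    \<comment> \<open>any point where the exponential bound lies below the diagonal serves as the upper end\<close>
    have "birth_rate n (3 * real n) \<le> exp (real n / (3 * real n))" using assms by (intro birth_rate_exp) simp
    also have "\<dots> \<le> exp 1" using assms by simp
    also have "\<dots> \<le> 3 * real n" using exp_le assms by (smt (verit) Suc_leI One_nat_def real_of_nat_ge_one_iff)
    finally show "0 \<le> 3 * real n - birth_rate n (3 * real n)" by simp
    show "continuous_on {1..3 * real n} (\<lambda>c. c - birth_rate n c)"
      unfolding birth_rate_def by (intro continuous_intros) auto
  qed
  then obtain c where c: "c \<ge> 1" "birth_rate n c = c" by auto
  have "exp (real n / (c + 1)) \<le> c" "c \<le> exp (real n / c)"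
    using birth_rate_exp[of c n] c by auto
  then have "real n / (c + 1) \<le> ln c" "ln c \<le> real n / c"
    using c(1) by (simp_all add: ln_ge_iff) (metis exp_gt_zero less_le_trans ln_exp ln_le_cancel_iff zero_less_one)
  then have "c * ln c \<le> real n" "real n \<le> (c + 1) * ln c"
    using c(1) by (simp_all add: field_simps)
  with c that show ?thesis by blast
qed

section \<open>The variance for a fixed number of elements\<close>

definition mean_variance :: "nat \<Rightarrow> (nat \<Rightarrow> real) \<Rightarrow> real" where
  "mean_variance n f = mean n (\<lambda>m. (f m - mean n f) ^ 2)"

lemma mean_variance_dev:
  assumes "poly_bounded f"
  shows "mean n (\<lambda>m. (f m - k) ^ 2) = mean_variance n f + (mean n f - k) ^ 2"
proof -
  have e: "mean n (\<lambda>m. (f m - k) ^ 2) = mean n (\<lambda>m. f m ^ 2) - 2 * k * mean n f + k ^ 2" for k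
  proof -
    have "(\<lambda>m. (f m - k) ^ 2) = (\<lambda>m. (f m ^ 2 - 2 * k * f m) + k ^ 2)"
      by (rule ext) (simp add: power2_eq_square algebra_simps)
    then show ?thesis using assms by (simp add: mean_add mean_diff mean_cmult)
  qed
  show ?thesis unfolding mean_variance_def e by (simp add: power2_eq_square algebra_simps)
qed

text \<open>
  The covariance is replaced by its bound from the inequality of arithmetic and geometric means. A large $t$
  shows that a second variance much smaller than the first one is negligible.
\<close>

lemma mean_variance_add_bounds:
  assumes "poly_bounded f" "poly_bounded g" "n > 0" "t > 0"
  shows "mean_variance n (\<lambda>m. f m + g m) \<le> (1 + 1 / t) * mean_variance n f + (1 + t) * mean_variance n g"
    and "(1 - 1 / t) * mean_variance n f - (t - 1) * mean_variance n g \<le> mean_variance n (\<lambda>m. f m + g m)"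
proof -
  define F where "F m = f m - mean n f" for m
  define G where "G m = g m - mean n g" for m
  have FG: "poly_bounded F" "poly_bounded G" unfolding F_def G_def using assms by simp_all
  have V: "mean_variance n f = mean n (\<lambda>m. F m ^ 2)" "mean_variance n g = mean n (\<lambda>m. G m ^ 2)"
    by (simp_all add: mean_variance_def F_def G_def)
  have W: "mean_variance n (\<lambda>m. f m + g m) = mean n (\<lambda>m. (F m + G m) ^ 2)"
    using assms by (simp add: mean_variance_def mean_add F_def G_def algebra_simps)
  have am: "0 \<le> x ^ 2 / t + t * y ^ 2 + 2 * x * y" "0 \<le> x ^ 2 / t + t * y ^ 2 - 2 * x * y" for x y
  proof -
    have "0 \<le> (x + t * y) ^ 2 / t" "0 \<le> (x - t * y) ^ 2 / t" using assms(4) by simp_all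
    then show "0 \<le> x ^ 2 / t + t * y ^ 2 + 2 * x * y" "0 \<le> x ^ 2 / t + t * y ^ 2 - 2 * x * y"
      using assms(4) by (simp_all add: power2_eq_square field_simps)
  qed
  have "mean n (\<lambda>m. (F m + G m) ^ 2) \<le> mean n (\<lambda>m. (1 + 1 / t) * F m ^ 2 + (1 + t) * G m ^ 2)"
  proof (rule mean_mono)
    show "(F m + G m) ^ 2 \<le> (1 + 1 / t) * F m ^ 2 + (1 + t) * G m ^ 2" for m
      using am(2)[of "F m" "G m"] by (simp add: power2_eq_square algebra_simps)
  qed (use FG assms in auto)
  then show "mean_variance n (\<lambda>m. f m + g m) \<le> (1 + 1 / t) * mean_variance n f + (1 + t) * mean_variance n g"
    unfolding V W using FG by (simp add: mean_add mean_cmult)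
  have "mean n (\<lambda>m. (1 - 1 / t) * F m ^ 2 - (t - 1) * G m ^ 2) \<le> mean n (\<lambda>m. (F m + G m) ^ 2)"
  proof (rule mean_mono)
    show "(1 - 1 / t) * F m ^ 2 - (t - 1) * G m ^ 2 \<le> (F m + G m) ^ 2" for m
      using am(1)[of "F m" "G m"] by (simp add: power2_eq_square algebra_simps)
  qed (use FG assms in auto)
  then show "(1 - 1 / t) * mean_variance n f - (t - 1) * mean_variance n g \<le> mean_variance n (\<lambda>m. f m + g m)"
    unfolding V W using FG by (simp add: mean_diff mean_cmult)
qed

lemma mean_variance_nonneg:
  assumes "poly_bounded f" "n > 0" shows "0 \<le> mean_variance n f"
  using mean_mono[of "\<lambda>_. 0" "\<lambda>m. (f m - mean n f) ^ 2" n] assms by (simp add: mean_variance_def)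

lemma mean_variance_cmult:
  assumes "poly_bounded f" shows "mean_variance n (\<lambda>m. k * f m) = k ^ 2 * mean_variance n f"
proof -
  have "(\<lambda>m. (k * f m - k * mean n f) ^ 2) = (\<lambda>m. k ^ 2 * (f m - mean n f) ^ 2)"
    by (rule ext) (simp add: power2_eq_square algebra_simps)
  then show ?thesis using assms by (simp add: mean_variance_def mean_cmult)
qed

text \<open>
  The variance of the crossings, times 144, arranged such that the leading terms of the second moment and of
  the squared mean, which cancel, disappear inside a variance.
\<close>

definition exact_variance :: "nat \<Rightarrow> real" where
  "exact_variance n = 9 * mean_variance n (\<lambda>m. 2 * real n * real m + (9 * real m - 5 * real m ^ 2))
     + (- 4 * mean n (\<lambda>m. real m ^ 3) + (12 * real n - 150) * mean n (\<lambda>m. real m ^ 2)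
     - (288 * real n + 422) * mean n real - 12 * real n - 32)"

text \<open>
  From here on $r = \ln c$ is large. In a window of radius of order $c / r^2$ about $c$ the slope of the birth rate lies
  between $-(r + 4)$ and $-(r - 4)$. This gives the upper bound \<open>U\<close> for the second moment of $M$ about $c$, and the lower
  bound \<open>W\<close> for the variance of $M$; both are $c / r$ up to a relative error of order $1 / r$.
\<close>

context
  fixes n :: nat and c r U W :: real
  assumes n: "n > 0" and c1: "c \<ge> 1" and fix_c: "birth_rate n c = c"
    and r: "r = ln c" "r > 4" and nc: "c * r \<le> real n" "real n \<le> (c + 1) * r"
    and slope_l: "r - 4 \<le> c * r / ((c + c / r ^ 2) * (c + c / r ^ 2 + 1)) * exp (c * r / (c + c / r ^ 2 + 1))"
    and slope_u: "(c + 1) * r / (c - 2 * (c / r ^ 2)) ^ 2 * exp ((c + 1) * r / (c - 2 * (c / r ^ 2))) \<le> r + 4"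
    and L: "2 * sqrt c + 1 \<le> c / r ^ 2"
  defines "U \<equiv> (c + 2 * sqrt c) / (r - 3) + 45 * r ^ 4"
    and "W \<equiv> (c - 2 * sqrt c - 90 * r ^ 6) / (r + 5)"
begin

lemma dev2_le: "mean n (\<lambda>m. (real m - c) ^ 2) \<le> U"
proof -
  let ?D = "mean n (\<lambda>m. (real m - c) ^ 2)" and ?L = "c / r ^ 2"
  have L0: "?L > 0" using c1 r(2) by (intro divide_pos_pos) auto
  have "(1 + (r - 4)) * ?D \<le> mean n real + (r - 4) * (45 * c ^ 2 / ?L ^ 2)"
  proof (rule mean_dev2_upper[OF n c1 fix_c L0])
    have "c * r / ((c + ?L) * (c + ?L + 1)) * exp (c * r / (c + ?L + 1))
       \<le> real n / ((c + ?L) * (c + ?L + 1)) * exp (real n / (c + ?L + 1))"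
      using nc(1) c1 L0 by (intro mult_mono divide_right_mono exp_le_cancel_iff[THEN iffD2]) auto
    then show "r - 4 \<le> real n / ((c + ?L) * (c + ?L + 1)) * exp (real n / (c + ?L + 1))"
      using slope_l by linarith
  qed (use r in simp)
  also have "c ^ 2 / ?L ^ 2 = r ^ 4" using c1 r by (simp add: power_divide)
  then have "45 * c ^ 2 / ?L ^ 2 = 45 * r ^ 4" by (metis times_divide_eq_right)
  also have "mean n real + (r - 4) * (45 * r ^ 4) \<le> (c + 2 * sqrt c) + (r - 3) * (45 * r ^ 4)"
    using mean_near[OF n c1 fix_c] r by (intro add_mono mult_right_mono) auto
  also have "(c + 2 * sqrt c) + (r - 3) * (45 * r ^ 4) = U * (r - 3)"
    unfolding U_def using r(2) by (simp add: field_simps)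
  also have "1 + (r - 4) = r - 3" by simp
  finally have "?D * (r - 3) \<le> U * (r - 3)" by (simp only: mult.commute)
  then show ?thesis using r by simp
qed

lemma variance_ge: "W \<le> mean_variance n real"
proof -
  let ?L = "c / r ^ 2"
  let ?B = "c - 2 * ?L"
  have B0: "?B > 0"
  proof -
    have "4 ^ 2 < r ^ 2" using r by (intro power_strict_mono) auto
    then have "?L < c / 4 ^ 2" using c1 by (intro divide_strict_left_mono) auto
    then have "?L < c / 16" by simp
    then show ?thesis using c1 by linarith
  qed
  have "mean n real \<le> (1 + (r + 4)) * mean n (\<lambda>m. (real m - mean n real) ^ 2) + 90 * c ^ 3 / ?L ^ 3"
  proof (rule variance_lower[OF n c1 fix_c L refl B0])
    have "real n / ?B ^ 2 * exp (real n / ?B) \<le> (c + 1) * r / ?B ^ 2 * exp ((c + 1) * r / ?B)"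
      using nc(2) c1 B0 r(2) by (intro mult_mono divide_right_mono exp_le_cancel_iff[THEN iffD2]) auto
    then show "real n / ?B ^ 2 * exp (real n / ?B) \<le> r + 4" using slope_u by linarith
  qed
  also have "c ^ 3 / ?L ^ 3 = r ^ 6" using c1 r by (simp add: power_divide)
  then have "90 * c ^ 3 / ?L ^ 3 = 90 * r ^ 6" by (metis times_divide_eq_right)
  also have "1 + (r + 4) = r + 5" by simp
  finally have "c - 2 * sqrt c - 90 * r ^ 6 \<le> (r + 5) * mean_variance n real"
    using mean_near[OF n c1 fix_c] unfolding mean_variance_def by linarith
  then show ?thesis using r by (simp add: W_def field_simps)
qed

lemma variance_le: "mean_variance n real \<le> U"
  using dev2_le mean_variance_dev[of real n c] by (smt (verit) poly_bounded_id zero_le_power2)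

lemma mean_bounds: "c - 2 * sqrt c \<le> mean n real" "mean n real \<le> c + 2 * sqrt c"
  using mean_near[OF n c1 fix_c] by auto

lemma sqrt_c: "2 * sqrt c \<le> c"
proof -
  have "c / r ^ 2 \<le> c / 1" using r c1 by (intro divide_left_mono) auto
  then show ?thesis using L by simp
qed

lemma mean_square_eq: "mean n (\<lambda>m. real m ^ 2) = mean_variance n real + (mean n real) ^ 2"
  using mean_variance_dev[of real n 0] by simp

lemma mean_square_bounds:
  "(c - 2 * sqrt c) ^ 2 \<le> mean n (\<lambda>m. real m ^ 2)" "mean n (\<lambda>m. real m ^ 2) \<le> U + (c + 2 * sqrt c) ^ 2"
proof -
  have "(c - 2 * sqrt c) ^ 2 \<le> (mean n real) ^ 2" "(mean n real) ^ 2 \<le> (c + 2 * sqrt c) ^ 2"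
    using mean_bounds sqrt_c by (auto intro!: power_mono)
  moreover have "0 \<le> mean_variance n real" using n by (simp add: mean_variance_nonneg)
  ultimately show "(c - 2 * sqrt c) ^ 2 \<le> mean n (\<lambda>m. real m ^ 2)" "mean n (\<lambda>m. real m ^ 2) \<le> U + (c + 2 * sqrt c) ^ 2"
    using variance_le unfolding mean_square_eq by auto
qed

lemma mean_cube_le: "mean n (\<lambda>m. real m ^ 3) \<le> 100 * c ^ 3"
proof -
  have "mean n (\<lambda>m. real m ^ 3) \<le> mean n (\<lambda>m. 4 * c ^ 3 + (2 * (real m - c) ^ 2 + 2 * (real m - c) ^ 4))"
  proof (rule mean_mono)
    fix m :: nat
    define x where "x = real m - c"
    have m: "real m = c + x" by (simp add: x_def)
    have "0 \<le> 3 * real m * (c - x) ^ 2" by simp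
    then have "real m ^ 3 \<le> 4 * c ^ 3 + 4 * x ^ 3"
      unfolding m by (simp add: power3_eq_cube power2_eq_square algebra_simps)
    moreover have "0 \<le> 2 * x ^ 2 * (x - 1) ^ 2" by simp
    then have "4 * x ^ 3 \<le> 2 * x ^ 2 + 2 * x ^ 4"
      by (simp add: eval_nat_numeral algebra_simps)
    ultimately show "real m ^ 3 \<le> 4 * c ^ 3 + (2 * (real m - c) ^ 2 + 2 * (real m - c) ^ 4)"
      by (simp add: x_def)
  qed (use n in auto)
  also have "\<dots> = 4 * c ^ 3 + (2 * mean n (\<lambda>m. (real m - c) ^ 2) + 2 * mean n (\<lambda>m. (real m - c) ^ 4))"
    by (subst mean_add | subst mean_cmult | simp)+
  also have "\<dots> \<le> 4 * c ^ 3 + (2 * (3 * c) + 2 * (45 * c ^ 2))"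
    using mean_dev2[OF n c1 fix_c] mean_dev4[OF n c1 fix_c] by linarith
  also have "\<dots> \<le> 100 * c ^ 3"
    using power_increasing[of 1 3 c] power_increasing[of 2 3 c] c1 by simp
  finally show ?thesis .
qed

text \<open>
  Near $c$ the square of the deviation from the value at $c$ is of order $c^2 (m - c)^2$.
\<close>

lemma quadratic_variance_le:
  "mean_variance n (\<lambda>m. 9 * real m - 5 * real m ^ 2) \<le> 2250 * c ^ 2 + 200 * c ^ 2 * U"
proof -
  let ?q = "\<lambda>m. 9 * real m - 5 * real m ^ 2" and ?k = "9 * c - 5 * c ^ 2"
  have "mean_variance n ?q \<le> mean n (\<lambda>m. (?q m - ?k) ^ 2)"
    using mean_variance_dev[of ?q n ?k] by simp
  also have "\<dots> \<le> mean n (\<lambda>m. 50 * (real m - c) ^ 4 + 200 * c ^ 2 * (real m - c) ^ 2)"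
  proof (rule mean_mono)
    fix m :: nat
    define x where "x = real m - c"
    have e: "?q m - ?k = x * ((9 - 10 * c) - 5 * x)"
      by (simp add: x_def power2_eq_square algebra_simps)
    have "0 \<le> ((9 - 10 * c) + 5 * x) ^ 2" by simp
    then have "((9 - 10 * c) - 5 * x) ^ 2 \<le> 2 * (9 - 10 * c) ^ 2 + 50 * x ^ 2"
      by (simp add: power2_eq_square algebra_simps)
    also have "(9 - 10 * c) ^ 2 \<le> (10 * c) ^ 2" using c1 by (intro abs_le_square_iff[THEN iffD1]) auto
    finally have "((9 - 10 * c) - 5 * x) ^ 2 \<le> 200 * c ^ 2 + 50 * x ^ 2" by (simp add: power_mult_distrib)
    from mult_left_mono[OF this, of "x ^ 2"]
    show "(?q m - ?k) ^ 2 \<le> 50 * (real m - c) ^ 4 + 200 * c ^ 2 * (real m - c) ^ 2"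
      unfolding e by (simp add: x_def[symmetric] power_mult_distrib eval_nat_numeral algebra_simps)
  qed (use n in auto)
  also have "\<dots> = 50 * mean n (\<lambda>m. (real m - c) ^ 4) + 200 * c ^ 2 * mean n (\<lambda>m. (real m - c) ^ 2)"
    by (subst mean_add | subst mean_cmult | simp)+
  also have "\<dots> \<le> 50 * (45 * c ^ 2) + 200 * c ^ 2 * U"
    using mean_dev4[OF n c1 fix_c] dev2_le by (intro add_mono mult_left_mono) auto
  finally show ?thesis by simp
qed

lemma exact_variance_le:
  "exact_variance n \<le> 9 * ((1 + 1 / r) * (4 * ((c + 1) * r) ^ 2 * U) + (1 + r) * (2250 * c ^ 2 + 200 * c ^ 2 * U))
     + 12 * ((c + 1) * r) * (U + (c + 2 * sqrt c) ^ 2)"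
proof -
  let ?q = "\<lambda>m. 9 * real m - 5 * real m ^ 2"
  have V: "mean_variance n (\<lambda>m. 2 * real n * real m) = 4 * real n ^ 2 * mean_variance n real"
    using mean_variance_cmult[of real n "2 * real n"] by (simp add: power_mult_distrib)
  have "real n ^ 2 * mean_variance n real \<le> ((c + 1) * r) ^ 2 * U"
    using nc(2) variance_le mean_variance_nonneg[of real n] n by (intro mult_mono power_mono) auto
  then have 1: "4 * real n ^ 2 * mean_variance n real \<le> 4 * ((c + 1) * r) ^ 2 * U" by simp
  have "mean_variance n (\<lambda>m. 2 * real n * real m + ?q m) \<le>
     (1 + 1 / r) * mean_variance n (\<lambda>m. 2 * real n * real m) + (1 + r) * mean_variance n ?q"
    by (rule mean_variance_add_bounds) (use n r in auto)
  also have "\<dots> \<le> (1 + 1 / r) * (4 * ((c + 1) * r) ^ 2 * U) + (1 + r) * (2250 * c ^ 2 + 200 * c ^ 2 * U)"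
    unfolding V using 1 quadratic_variance_le r by (intro add_mono mult_left_mono) auto
  finally have 2: "9 * mean_variance n (\<lambda>m. 2 * real n * real m + ?q m) \<le>
     9 * ((1 + 1 / r) * (4 * ((c + 1) * r) ^ 2 * U) + (1 + r) * (2250 * c ^ 2 + 200 * c ^ 2 * U))" by simp
  have pos: "0 \<le> mean n (\<lambda>m. real m ^ k)" for k
    using mean_mono[of "\<lambda>_. 0" "\<lambda>m. real m ^ k" n] n by simp
  have "real n * mean n (\<lambda>m. real m ^ 2) \<le> ((c + 1) * r) * (U + (c + 2 * sqrt c) ^ 2)"
    using nc(2) mean_square_bounds(2) pos c1 r by (intro mult_mono) auto
  moreover have "0 \<le> (288 * real n + 422) * mean n real" using pos[of 1] by simp
  ultimately show ?thesis
    unfolding exact_variance_def using 2 pos[of 3] pos[of 2] by (simp add: algebra_simps)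
qed

lemma exact_variance_ge:
  "9 * ((1 - 1 / r) * (4 * (c * r) ^ 2 * W) - (r - 1) * (2250 * c ^ 2 + 200 * c ^ 2 * U))
     - 400 * c ^ 3 + 12 * (c * r) * (c - 2 * sqrt c) ^ 2 - 150 * (U + (c + 2 * sqrt c) ^ 2)
     - (288 * ((c + 1) * r) + 422) * (c + 2 * sqrt c) - 12 * ((c + 1) * r) - 32 \<le> exact_variance n"
proof -
  let ?q = "\<lambda>m. 9 * real m - 5 * real m ^ 2"
  have V: "mean_variance n (\<lambda>m. 2 * real n * real m) = 4 * real n ^ 2 * mean_variance n real"
    using mean_variance_cmult[of real n "2 * real n"] by (simp add: power_mult_distrib)
  have "(c * r) ^ 2 * W \<le> (c * r) ^ 2 * mean_variance n real"
    using variance_ge by (intro mult_left_mono) auto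
  also have "\<dots> \<le> real n ^ 2 * mean_variance n real"
    using nc(1) c1 r mean_variance_nonneg[of real n] n by (intro mult_right_mono power_mono) auto
  finally have 1: "4 * (c * r) ^ 2 * W \<le> 4 * real n ^ 2 * mean_variance n real" by simp
  have "(1 - 1 / r) * (4 * (c * r) ^ 2 * W) - (r - 1) * (2250 * c ^ 2 + 200 * c ^ 2 * U) \<le>
     (1 - 1 / r) * mean_variance n (\<lambda>m. 2 * real n * real m) - (r - 1) * mean_variance n ?q"
    unfolding V using 1 quadratic_variance_le r by (intro diff_mono mult_left_mono) auto
  also have "\<dots> \<le> mean_variance n (\<lambda>m. 2 * real n * real m + ?q m)"
    by (rule mean_variance_add_bounds) (use n r in auto)
  finally have 2: "9 * ((1 - 1 / r) * (4 * (c * r) ^ 2 * W) - (r - 1) * (2250 * c ^ 2 + 200 * c ^ 2 * U))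
     \<le> 9 * mean_variance n (\<lambda>m. 2 * real n * real m + ?q m)" by simp
  have "(c * r) * (c - 2 * sqrt c) ^ 2 \<le> real n * mean n (\<lambda>m. real m ^ 2)"
    using nc(1) mean_square_bounds(1) c1 r by (intro mult_mono) auto
  then have 3: "12 * (c * r) * (c - 2 * sqrt c) ^ 2 \<le> 12 * real n * mean n (\<lambda>m. real m ^ 2)" by simp
  have pos: "0 \<le> mean n real" using mean_mono[of "\<lambda>_. 0" real n] n by simp
  have "(288 * real n + 422) * mean n real \<le> (288 * ((c + 1) * r) + 422) * (c + 2 * sqrt c)"
    using nc(2) mean_bounds(2) pos c1 r by (intro mult_mono) auto
  moreover have "(12 * real n - 150) * mean n (\<lambda>m. real m ^ 2)
      = 12 * real n * mean n (\<lambda>m. real m ^ 2) - 150 * mean n (\<lambda>m. real m ^ 2)"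
    by (simp add: left_diff_distrib)
  moreover have "A - 400 * C + P - 150 * Q - S - 12 * T - 32 \<le> A' + (- 4 * M\<^sub>3 + X - S' - 12 * N - 32)"
    if "S' \<le> S" "X = P' - 150 * M\<^sub>2" "A \<le> A'" "P \<le> P'" "M\<^sub>3 \<le> 100 * C" "M\<^sub>2 \<le> Q" "N \<le> T"
    for A A' C P P' Q S S' T X N M\<^sub>2 M\<^sub>3 :: real
    using that by linarith
  ultimately show ?thesis
    unfolding exact_variance_def
    using 2 3 mean_cube_le mean_square_bounds(2) nc(2) by blast
qed

end

section \<open>Asymptotics\<close>

definition dev_bound :: "real \<Rightarrow> real" where
  "dev_bound r = (exp r + 2 * sqrt (exp r)) / (r - 3) + 45 * r ^ 4"

definition var_bound :: "real \<Rightarrow> real" where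
  "var_bound r = (exp r - 2 * sqrt (exp r) - 90 * r ^ 6) / (r + 5)"

text \<open>
  Near $e^r$, up to distances of order $e^r / r^2$, the slope of the birth rate differs from $-r$ by at most 4.
  A window of this width is wide compared with the standard deviation, of order $\sqrt{e^r / r}$, and
  narrow compared with $e^r / r$, the scale on which the slope changes.
\<close>

lemma regime_conditions:
  "\<forall>\<^sub>F r :: real in at_top. r > 4 \<and> exp r \<ge> 1 \<and>
    r - 4 \<le> exp r * r / ((exp r + exp r / r ^ 2) * (exp r + exp r / r ^ 2 + 1)) * exp (exp r * r / (exp r + exp r / r ^ 2 + 1)) \<and>
    (exp r + 1) * r / (exp r - 2 * (exp r / r ^ 2)) ^ 2 * exp ((exp r + 1) * r / (exp r - 2 * (exp r / r ^ 2))) \<le> r + 4 \<and>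
    2 * sqrt (exp r) + 1 \<le> exp r / r ^ 2"
  by (intro eventually_conj; real_asymp)

lemma exact_variance_upper_asymp:
  "\<forall>\<^sub>F r :: real in at_top. 9 * ((1 + 1 / r) * (4 * ((exp r + 1) * r) ^ 2 * dev_bound r) + (1 + r) * (2250 * exp r ^ 2 + 200 * exp r ^ 2 * dev_bound r))
     + 12 * ((exp r + 1) * r) * (dev_bound r + (exp r + 2 * sqrt (exp r)) ^ 2) \<le> 48 * (exp r ^ 3 * (r + 100))"
  unfolding dev_bound_def by real_asymp

lemma exact_variance_lower_asymp:
  "\<forall>\<^sub>F r :: real in at_top. 48 * (exp r ^ 3 * (r - 100)) \<le> 
   9 * ((1 - 1 / r) * (4 * (exp r * r) ^ 2 * var_bound r) - (r - 1) * (2250 * exp r ^ 2 + 200 * exp r ^ 2 * dev_bound r))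
     - 400 * exp r ^ 3 + 12 * (exp r * r) * (exp r - 2 * sqrt (exp r)) ^ 2 - 150 * (dev_bound r + (exp r + 2 * sqrt (exp r)) ^ 2)
     - (288 * ((exp r + 1) * r) + 422) * (exp r + 2 * sqrt (exp r)) - 12 * ((exp r + 1) * r) - 32"
  unfolding dev_bound_def var_bound_def by real_asymp

text \<open>
  Since $n \approx r e^r$, the quotient $(\ln n)^2 / r^2$ is $1 + 2 \ln r / r$ up to
  terms of smaller order; the error of order $1 / r$ in the variance disappears against $\ln r / r$.
\<close>

lemma lower_quotient_tendsto: "((\<lambda>r :: real. (exp r ^ 3 * (r - 100) * (ln (exp r * r)) ^ 2 / ((exp r + 1) * r) ^ 3 - 1) *
   (ln (exp r * r) / (2 * ln (ln ((exp r + 1) * r))))) \<longlongrightarrow> 1) at_top"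
  by real_asymp

lemma upper_quotient_tendsto: "((\<lambda>r :: real. (exp r ^ 3 * (r + 100) * (ln ((exp r + 1) * r)) ^ 2 / (exp r * r) ^ 3 - 1) *
   (ln ((exp r + 1) * r) / (2 * ln (ln (exp r * r))))) \<longlongrightarrow> 1) at_top"
  by real_asymp

lemma lower_quotient_nonneg:
  "\<forall>\<^sub>F r :: real in at_top. 0 \<le> exp r ^ 3 * (r - 100) * (ln (exp r * r)) ^ 2 / ((exp r + 1) * r) ^ 3 - 1"
  by real_asymp


text \<open>
  The main term of $144\,\mathrm{Var}(X)$ is $36 c^3 r + 12 c^3 r$, from $36 n^2 \mathrm{Var}(M)$ and
  from $12 n \mathrm{E}(M^2)$ with $n \approx c r$, $\mathrm{Var}(M) \approx c / r$ and
  $\mathrm{E}(M^2) \approx c^2$. All other terms are of order $c^3$; the constant 100 is generous.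
\<close>

lemma exact_variance_bounds:
  "\<forall>\<^sub>F r in at_top. \<forall>n c. n > 0 \<longrightarrow> birth_rate n c = c \<longrightarrow> r = ln c \<longrightarrow> c > 0 \<longrightarrow> c * r \<le> real n \<longrightarrow> real n \<le> (c + 1) * r \<longrightarrow>
     48 * (c ^ 3 * (r - 100)) \<le> exact_variance n \<and> exact_variance n \<le> 48 * (c ^ 3 * (r + 100))"
  using regime_conditions exact_variance_upper_asymp exact_variance_lower_asymp
proof eventually_elim
  case (elim r)
  show ?case
  proof (intro allI impI)
    fix n c assume *: "n > 0" "birth_rate n c = c" "r = ln c" "c > 0" "c * r \<le> real n" "real n \<le> (c + 1) * r"
    have c: "c = exp r" using * by simp
    show "48 * (c ^ 3 * (r - 100)) \<le> exact_variance n \<and> exact_variance n \<le> 48 * (c ^ 3 * (r + 100))"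
      using exact_variance_le[OF *(1) _ *(2,3) _ *(5,6)] exact_variance_ge[OF *(1) _ *(2,3) _ *(5,6)] elim
      unfolding c dev_bound_def var_bound_def by (meson order_trans)
  qed
qed

lemma touchard_moment:
  "poly (touchard (n + j)) 0 / poly (touchard n) 0 = mean n (\<lambda>m. real m ^ j)"
proof -
  have "(\<lambda>m. weight n m * real m ^ j) sums (poly (touchard (n + j)) 0 * exp 1)" for j
    using touchard_sums[of "n + j" 0] by (simp add: weight_def power_add)
  note s = this[of j] this[of 0]
  have "mean n (\<lambda>m. real m ^ j) = (poly (touchard (n + j)) 0 * exp 1) / (poly (touchard n) 0 * exp 1)"
    using s by (simp add: mean_def total_weight_def sums_iff)
  then show ?thesis by simp
qed

lemma variance_eq_exact_variance:
  "144 * measure_pmf.variance (random_partition n) (\<lambda>P. real (linear_crossings P)) = exact_variance n"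
proof -
  let ?M = "\<lambda>k. mean n (\<lambda>m. real m ^ k)"
  let ?f = "\<lambda>m. 2 * real n * real m + (9 * real m - 5 * real m ^ 2)"
  have mf: "mean n ?f = (2 * real n + 9) * ?M 1 - 5 * ?M 2"
  proof -
    have "mean n ?f = 2 * real n * mean n real + (9 * mean n real - 5 * ?M 2)"
      by (subst mean_add | subst mean_diff | subst mean_cmult | simp)+
    then show ?thesis by (simp add: algebra_simps)
  qed
  have "mean n (\<lambda>m. ?f m ^ 2) = mean n (\<lambda>m. ((2 * real n + 9) ^ 2 * real m ^ 2 - 10 * (2 * real n + 9) * real m ^ 3) + 25 * real m ^ 4)"
    by (rule arg_cong[of _ _ "mean n"], rule ext) (simp add: eval_nat_numeral algebra_simps)
  also have "\<dots> = (2 * real n + 9) ^ 2 * ?M 2 - 10 * (2 * real n + 9) * ?M 3 + 25 * ?M 4"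
    by (simp add: mean_add mean_diff mean_cmult)
  finally have mf2: "mean n (\<lambda>m. ?f m ^ 2) = (2 * real n + 9) ^ 2 * ?M 2 - 10 * (2 * real n + 9) * ?M 3 + 25 * ?M 4" .
  have "mean_variance n ?f = mean n (\<lambda>m. ?f m ^ 2) - (mean n ?f) ^ 2"
    using mean_variance_dev[of ?f n 0] by simp
  then have v: "mean_variance n ?f = (2 * real n + 9) ^ 2 * ?M 2 - 10 * (2 * real n + 9) * ?M 3 + 25 * ?M 4
     - ((2 * real n + 9) * ?M 1 - 5 * ?M 2) ^ 2"
    unfolding mf mf2 .
  show ?thesis
    unfolding variance_crossings_exact touchard_moment exact_variance_def v
    by (simp add: power2_eq_square algebra_simps)
qed

theorem theorem1p9:
  shows "\<exists>\<epsilon> :: nat \<Rightarrow> real. \<epsilon> \<longlonglongrightarrow> 0 \<and>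
    (\<forall>\<^sub>F n in sequentially.
       measure_pmf.variance (random_partition n) (\<lambda>P. real (linear_crossings P)) =
         real n ^ 3 / (3 * (ln (real n))\<^sup>2) *
           (1 + 2 * (ln (ln (real n)) / ln (real n)) * (1 + \<epsilon> n)))"
proof -
  define v where "v n = measure_pmf.variance (random_partition n) (\<lambda>P. real (linear_crossings P))" for n
  have "\<exists>c. n > 0 \<longrightarrow> c \<ge> 1 \<and> birth_rate n c = c \<and> c * ln c \<le> real n \<and> real n \<le> (c + 1) * ln c" for n
    using birth_rate_fixed_point[of n] by metis
  then obtain c where c: "\<And>n. n > 0 \<Longrightarrow> c n \<ge> 1 \<and> birth_rate n (c n) = c n \<and> c n * ln (c n) \<le> real n \<and> real n \<le> (c n + 1) * ln (c n)"
    by metis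
  define r where "r n = ln (c n)" for n
  have r: "c n = exp (r n)" "exp (r n) * r n \<le> real n" "real n \<le> (exp (r n) + 1) * r n" if "n > 0" for n
    using c[OF that] by (auto simp: r_def)
  have pos: "\<forall>\<^sub>F n :: nat in sequentially. n > 0" by (rule eventually_gt_at_top)
  have lim: "filterlim r at_top sequentially"
  proof (rule filterlim_at_top_mono)
    show "filterlim (\<lambda>n. ln (real n / 2) / 2) at_top sequentially" by real_asymp
    show "\<forall>\<^sub>F n in sequentially. ln (real n / 2) / 2 \<le> r n"
      using pos
    proof eventually_elim
      case (elim n)
      have c1: "c n \<ge> 1" using c[OF elim] by blast
      have "real n \<le> (c n + 1) * ln (c n)" using c[OF elim] by blast
      also have "\<dots> \<le> (2 * c n) * c n" using c1 ln_le_minus_one[of "c n"] by (intro mult_mono) auto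
      finally have "real n / 2 \<le> c n ^ 2" by (simp add: power2_eq_square)
      then have "ln (real n / 2) \<le> ln (c n ^ 2)" using elim c1 by (subst ln_le_cancel_iff) auto
      then show ?case using c1 by (simp add: r_def ln_realpow)
    qed
  qed
  have ev: "\<forall>\<^sub>F n in sequentially. P (r n)" if "\<forall>\<^sub>F x in at_top. P x" for P
    using lim that by (simp add: filterlim_iff)
  \<comment> \<open>solving the claimed equation for \<open>1 + \<epsilon> n\<close> gives \<open>T n * G n\<close>\<close>
  define T where "T n = 3 * v n * (ln (real n))\<^sup>2 / real n ^ 3 - 1" for n
  define G where "G n = ln (real n) / (2 * ln (ln (real n)))" for n
  have bounds: "\<forall>\<^sub>F n in sequentially. exp (r n) ^ 3 * (r n - 100) \<le> 3 * v n \<and> 3 * v n \<le> exp (r n) ^ 3 * (r n + 100)"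
    using ev[OF exact_variance_bounds] pos
  proof eventually_elim
    case (elim n)
    have "c n > 0" using c[OF elim(2)] by auto
    then show ?case
      using elim(1)[rule_format, of n "c n"] c[OF elim(2)] elim(2) r(1)[OF elim(2)] variance_eq_exact_variance[of n]
      unfolding r_def v_def[symmetric] by auto
  qed
  \<comment> \<open>the two bounds for \<open>n\<close> in terms of \<open>r\<close>\<close>
  let ?l = "\<lambda>r. exp r * r :: real" and ?u = "\<lambda>r. (exp r + 1) * r :: real"
  have big: "\<forall>\<^sub>F x in at_top. exp x * x > exp 1 \<and> x > (100 :: real)"
    by (intro eventually_conj; real_asymp)
  have TG: "\<forall>\<^sub>F n in sequentially.
      (exp (r n) ^ 3 * (r n - 100) * (ln (?l (r n))) ^ 2 / ?u (r n) ^ 3 - 1) * (ln (?l (r n)) / (2 * ln (ln (?u (r n))))) \<le> T n * G n \<and>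
      T n * G n \<le> (exp (r n) ^ 3 * (r n + 100) * (ln (?u (r n))) ^ 2 / ?l (r n) ^ 3 - 1) * (ln (?u (r n)) / (2 * ln (ln (?l (r n)))))"
    using bounds ev[OF big] ev[OF lower_quotient_nonneg] pos
  proof eventually_elim
    case (elim n)
    define R where "R = r n"
    note e = elim(1,2,3)[folded R_def]
    have l: "exp 1 < ?l R" "?l R \<le> real n" "real n \<le> ?u R"
      using r(2,3)[OF elim(4)] e(2) by (auto simp: R_def)
    have l0: "0 < ?l R" "0 < real n" "0 < ?u R" using l exp_gt_zero[of "1 :: real"] by linarith+
    have ln1: "1 < ln (?l R)" using l(1) l0(1) by (metis exp_gt_zero ln_exp ln_less_cancel_iff)
    have ln2: "ln (?l R) \<le> ln (real n)" "ln (real n) \<le> ln (?u R)" using l l0 by (auto simp: ln_le_cancel_iff simp del: ln_mult_pos)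
    have ln3: "0 < ln (ln (?l R))" "ln (ln (?l R)) \<le> ln (ln (real n))" "ln (ln (real n)) \<le> ln (ln (?u R))"
      using ln1 ln2 by (auto simp del: ln_mult_pos)
    have v0: "0 \<le> 3 * v n"
      by (rule order_trans[OF _ conjunct1[OF e(1)]]) (use e(2) in simp)
    have T1: "exp R ^ 3 * (R - 100) * (ln (?l R)) ^ 2 / ?u R ^ 3 \<le> 3 * v n * (ln (real n))\<^sup>2 / real n ^ 3"
    proof (rule frac_le)
      show "exp R ^ 3 * (R - 100) * (ln (?l R))\<^sup>2 \<le> 3 * v n * (ln (real n))\<^sup>2"
      proof (rule mult_mono)
        show "exp R ^ 3 * (R - 100) \<le> 3 * v n" using e(1) by blast
        show "(ln (?l R))\<^sup>2 \<le> (ln (real n))\<^sup>2" using ln1 ln2 by (intro power_mono) linarith+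
      qed (use v0 in simp_all)
      show "0 \<le> 3 * v n * (ln (real n))\<^sup>2"
        using v0 by simp
      show "0 < real n ^ 3" "real n ^ 3 \<le> ?u R ^ 3" using l l0 by (auto intro: power_mono)
    qed
    have T2: "3 * v n * (ln (real n))\<^sup>2 / real n ^ 3 \<le> exp R ^ 3 * (R + 100) * (ln (?u R)) ^ 2 / ?l R ^ 3"
    proof (rule frac_le)
      show "3 * v n * (ln (real n))\<^sup>2 \<le> exp R ^ 3 * (R + 100) * (ln (?u R)) ^ 2"
      proof (rule mult_mono)
        show "3 * v n \<le> exp R ^ 3 * (R + 100)" using e(1) by blast
        show "(ln (real n))\<^sup>2 \<le> (ln (?u R))\<^sup>2" using ln1 ln2 by (intro power_mono) linarith+
      qed (use e(2) in simp_all)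
      show "0 \<le> exp R ^ 3 * (R + 100) * (ln (?u R)) ^ 2" using e(2) by simp
      show "0 < ?l R ^ 3" using l0(1) by (rule zero_less_power)
      show "?l R ^ 3 \<le> real n ^ 3" using l l0 by (intro power_mono) auto
    qed
    have G1: "ln (?l R) / (2 * ln (ln (?u R))) \<le> G n"
      unfolding G_def using ln1 ln2 ln3 by (intro frac_le) auto
    have G2: "G n \<le> ln (?u R) / (2 * ln (ln (?l R)))"
      unfolding G_def using ln1 ln2 ln3 by (intro frac_le) auto
    have G0: "0 \<le> ln (?l R) / (2 * ln (ln (?u R)))" using ln1 ln2 ln3 by (intro divide_nonneg_nonneg) auto
    show ?case unfolding R_def[symmetric] T_def
      using T1 T2 G1 G2 G0 e(3) by (intro conjI mult_mono) auto
  qed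
  have TG1: "(\<lambda>n. T n * G n) \<longlonglongrightarrow> 1"
  proof (rule tendsto_sandwich)
    show "\<forall>\<^sub>F n in sequentially. (exp (r n) ^ 3 * (r n - 100) * (ln (?l (r n))) ^ 2 / ?u (r n) ^ 3 - 1) * (ln (?l (r n)) / (2 * ln (ln (?u (r n))))) \<le> T n * G n"
      using TG by (rule eventually_mono) blast
    show "\<forall>\<^sub>F n in sequentially. T n * G n \<le> (exp (r n) ^ 3 * (r n + 100) * (ln (?u (r n))) ^ 2 / ?l (r n) ^ 3 - 1) * (ln (?u (r n)) / (2 * ln (ln (?l (r n)))))"
      using TG by (rule eventually_mono) blast
  qed (rule filterlim_compose[OF lower_quotient_tendsto lim] filterlim_compose[OF upper_quotient_tendsto lim])+
  have "(\<lambda>n. T n * G n - 1) \<longlonglongrightarrow> 0" using tendsto_diff[OF TG1 tendsto_const[of 1]] by simp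
  moreover have "\<forall>\<^sub>F n :: nat in sequentially. real n > 0 \<and> ln (real n) > 0 \<and> ln (ln (real n)) > 0"
    by (intro eventually_conj; real_asymp)
  then have "\<forall>\<^sub>F n in sequentially. v n = real n ^ 3 / (3 * (ln (real n))\<^sup>2) *
           (1 + 2 * (ln (ln (real n)) / ln (real n)) * (1 + (T n * G n - 1)))"
  proof eventually_elim
    case (elim n)
    have "2 * (b / a) * (1 + (t * (a / (2 * b)) - 1)) = t" if "a > 0" "b > 0" for a b t :: real
      using that by simp
    then have "2 * (ln (ln (real n)) / ln (real n)) * (1 + (T n * G n - 1)) = T n"
      using elim unfolding G_def by blast
    moreover have "x = N / (3 * l) * (1 + (3 * x * l / N - 1))" if "N \<noteq> 0" "l \<noteq> 0" for x N l :: real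
      using that by simp
    moreover have "real n ^ 3 \<noteq> 0" "(ln (real n))\<^sup>2 \<noteq> 0"
      using elim by (metis less_irrefl power_not_zero)+
    ultimately show ?case unfolding T_def by metis
  qed
  ultimately show ?thesis unfolding v_def by blast
qed

end
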